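(* Let $n,\ell\ge 1$ be integers and suppose $\ell\geq 2n$. (1) There exists an $\mathrm{O}(n)$-bi-Lipschitz map $\phi':\mathbb{R}^{n\times\ell}\to\mathbb{R}^{n(2\ell-2n+1)}$. (2) There exists an $\mathrm{E}(n)$-bi-Lipschitz map $\psi':\mathbb{R}^{n\times\ell}\to\mathbb{R}^{n(2\ell-2n-1)}$. (3) There exists a $\mathrm{U}(n)$-bi-Lipschitz map $\phi'_{\mathbb{C}}:\mathbb{C}^{n\times\ell}\to\mathbb{R}^{4n(\ell-n)}$. (4) There exists an $\mathrm{F}(n)$-bi-Lipschitz map $\psi'_{\mathbb{C}}:\mathbb{C}^{n\times\ell}\to\mathbb{R}^{m}$ where $m=4n(\ell-n-1)$.
   Context: Matrix spaces carry the Frobenius norm $\|A\|=\sqrt{\operatorname{trace}(AA^\star)}$ (with $A^\star$ the conjugate transpose), and $\mathbb{R}^m$ the euclidean norm; $d(x,y)=\|x-y\|$. The groups $\mathrm{O}(n)$ (orthogonal) and $\mathrm{U}(n)$ (unitary) act on $\mathbb{R}^{n\times\ell}$, resp. $\mathbb{C}^{n\times\ell}$, by left multiplication. $\mathrm{E}(n)$ is the group of pairs $g=(P,q)$ with $P\in\mathrm{O}(n)$, $q\in\mathbb{R}^n$, and $\mathrm{F}(n)$ the group of pairs $g=(P,q)$ with $P\in\mathrm{U}(n)$, $q\in\mathbb{C}^n$; they act on vectors by $g\cdot a=Pa+q$ and on $n\times\ell$ matrices (real, resp. complex) columnwise. For each such group $G$ acting on a matrix space $V$, $d_G(A,B)=\min_{g\in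 G}\|g\cdot A-B\|$. A function $f:V\to\mathbb{R}^m$ is called $G$-bi-Lipschitz if there exist constants $C_1,C_2>0$ such that $C_1d_G(A,B)\le d(f(A),f(B))\le C_2d_G(A,B)$ for all $A,B\in V$.
   Formalization: Part (4) is stated only for m ≥ 1, which excludes just n=1, ℓ=2 (m=0); there the claim is false, since any map into R^0 is constant while d_F((0,0),(0,1)) > 0. *)

theory Defs
  imports "HOL-Analysis.Analysis"
begin

definition cadjoint :: "complex^'n^'m \<Rightarrow> complex^'m^'n" where
  "cadjoint A = (\<chi> i j. cnj (A $ j $ i))"

definition unitary_matrix :: "complex^'n^'n \<Rightarrow> bool" where
  "unitary_matrix U \<longleftrightarrow> cadjoint U ** U = mat 1 \<and> U ** cadjoint U = mat 1"

text \<open>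
  An \<open>n \<times> l\<close> matrix has type \<^typ>\<open>'a^'l^'n\<close>. The library norm on such a type is the
  Frobenius norm:
\<close>

lemma norm_eq_frobenius_complex:
  fixes A :: "complex^'l^'n"
  shows "norm A = sqrt (Re (trace (A ** cadjoint A)))"
proof -
  have tr: "trace (A ** cadjoint A) = complex_of_real ((norm A)\<^sup>2)"
    by (simp add: trace_def matrix_matrix_mult_def cadjoint_def norm_vec_def L2_set_def
        sum_nonneg complex_norm_square[symmetric] flip: of_real_sum of_real_power)
  show "norm A = sqrt (Re (trace (A ** cadjoint A)))"
    unfolding tr by (simp flip: of_real_power)
qed

lemma norm_eq_frobenius_real:
  fixes A :: "real^'l^'n"
  shows "norm A = sqrt (trace (A ** transpose A))"
  by (simp add: trace_def matrix_matrix_mult_def transpose_def norm_vec_def L2_set_def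
      sum_nonneg power2_eq_square)

definition orthogonal_group :: "(real^'n^'n) set" where
  "orthogonal_group = {P. orthogonal_matrix P}"

definition unitary_group :: "(complex^'n^'n) set" where
  "unitary_group = {P. unitary_matrix P}"

definition real_euclidean_group :: "((real^'n^'n) \<times> (real^'n)) set" where
  "real_euclidean_group = {(P, q). orthogonal_matrix P}"

definition complex_euclidean_group :: "((complex^'n^'n) \<times> (complex^'n)) set" where
  "complex_euclidean_group = {(P, q). unitary_matrix P}"

definition affine_act :: "('a::semiring_1^'n^'n) \<times> ('a^'n) \<Rightarrow> 'a^'n \<Rightarrow> 'a^'n" where
  "affine_act g a = fst g *v a + snd g"

definition affine_act_columns ::
  "('a::semiring_1^'n^'n) \<times> ('a^'n) \<Rightarrow> 'a^'l^'n \<Rightarrow> 'a^'l^'n" where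
  "affine_act_columns g A = (\<chi> i j. affine_act g (column j A) $ i)"

text \<open>
  The infimum below is a minimum for each of the four groups considered here, see
  \<open>orbit_dist_attained\<close>.
\<close>

definition orbit_dist :: "'g set \<Rightarrow> ('g \<Rightarrow> 'v \<Rightarrow> 'v) \<Rightarrow> 'v \<Rightarrow> 'v::real_normed_vector \<Rightarrow> real" where
  "orbit_dist G act A B = (INF g\<in>G. norm (act g A - B))"

definition bi_lipschitz_wrt ::
  "'g set \<Rightarrow> ('g \<Rightarrow> 'v \<Rightarrow> 'v) \<Rightarrow> ('v::real_normed_vector \<Rightarrow> 'w::metric_space) \<Rightarrow> bool" where
  "bi_lipschitz_wrt G act f \<longleftrightarrow>
     (\<exists>C1 C2. C1 > 0 \<and> C2 > 0 \<and>
        (\<forall>A B. C1 * orbit_dist G act A B \<le> dist (f A) (f B) \<and>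
               dist (f A) (f B) \<le> C2 * orbit_dist G act A B))"

lemma orbit_dist_eq_min:
  assumes "g \<in> G" and "\<And>h. h \<in> G \<Longrightarrow> norm (act g A - B) \<le> norm (act h A - B)"
  shows "orbit_dist G act A B = norm (act g A - B)"
  unfolding orbit_dist_def using assms by (intro cInf_eq_minimum) auto

lemma compact_orthogonal_group: "compact (orthogonal_group :: (real^'n^'n) set)"
proof -
  have "norm P = sqrt (CARD('n))" if "orthogonal_matrix P" for P :: "real^'n^'n"
    using that unfolding norm_eq_frobenius_real orthogonal_matrix_def
    by (simp add: trace_def mat_def)
  then have "bounded (orthogonal_group :: (real^'n^'n) set)"
    unfolding bounded_iff orthogonal_group_def by (metis mem_Collect_eq order_refl)
  moreover have "closed (orthogonal_group :: (real^'n^'n) set)"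
    unfolding orthogonal_group_def orthogonal_matrix_def matrix_matrix_mult_def transpose_def
    by (intro closed_Collect_conj closed_Collect_eq continuous_intros)
  ultimately show ?thesis by (simp add: compact_eq_bounded_closed)
qed

lemma compact_unitary_group: "compact (unitary_group :: (complex^'n^'n) set)"
proof -
  have "norm P = sqrt (CARD('n))" if "unitary_matrix P" for P :: "complex^'n^'n"
    using that unfolding norm_eq_frobenius_complex unitary_matrix_def
    by (simp add: trace_def mat_def)
  then have "bounded (unitary_group :: (complex^'n^'n) set)"
    unfolding bounded_iff unitary_group_def by (metis mem_Collect_eq order_refl)
  moreover have "closed (unitary_group :: (complex^'n^'n) set)"
    unfolding unitary_group_def unitary_matrix_def matrix_matrix_mult_def cadjoint_def
    by (intro closed_Collect_conj closed_Collect_eq continuous_intros)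
  ultimately show ?thesis by (simp add: compact_eq_bounded_closed)
qed

lemma attained_linear:
  fixes G :: "('a::real_normed_field^'n^'n) set" and A B :: "'a^'l^'n"
  assumes "compact G" "G \<noteq> {}"
  shows "\<exists>g\<in>G. orbit_dist G (**) A B = norm (g ** A - B)"
proof -
  have "continuous_on G (\<lambda>g. norm (g ** A - B))"
    unfolding matrix_matrix_mult_def by (intro continuous_intros)
  from continuous_attains_inf[OF assms this] show ?thesis
    by (metis orbit_dist_eq_min)
qed

lemma attained_affine:
  fixes K :: "('a::{real_normed_field,euclidean_space}^'n^'n) set" and A B :: "'a^'l^'n"
  assumes "compact K" "K \<noteq> {}"
  shows "\<exists>g\<in>K \<times> UNIV. orbit_dist (K \<times> UNIV) affine_act_columns A B
                     = norm (affine_act_columns g A - B)"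
proof -
  let ?F = "\<lambda>g. norm (affine_act_columns g A - B)"
  obtain P0 where P0: "P0 \<in> K" using assms by blast
  define j :: 'l where "j = undefined"
  have cont: "continuous_on S ?F" for S
    unfolding affine_act_columns_def affine_act_def matrix_vector_mult_def
    by (intro continuous_intros)
  have "continuous_on K (\<lambda>P. P *v column j A - column j B)"
    unfolding matrix_vector_mult_def by (intro continuous_intros)
  then have "bounded ((\<lambda>P. P *v column j A - column j B) ` K)"
    using assms compact_continuous_image compact_imp_bounded by blast
  then obtain M where M: "\<And>P. P \<in> K \<Longrightarrow> norm (P *v column j A - column j B) \<le> M"
    unfolding bounded_iff by blast
  have col: "norm (column j X) \<le> norm X" for X :: "'a^'l^'n"
    unfolding norm_vec_def[of "column j X"] norm_vec_def[of X]
    by (intro L2_set_mono) (auto simp: column_def Finite_Cartesian_Product.norm_nth_le)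
  define R where "R = M + ?F (P0, 0)"
  have "M \<ge> 0" using M[OF P0] norm_ge_zero order_trans by blast
  then have "R \<ge> 0" unfolding R_def by simp
  have "compact (K \<times> cball (0::'a^'n) R)" using assms by (simp add: compact_Times)
  moreover have "(P0, 0) \<in> K \<times> cball (0::'a^'n) R" using P0 \<open>R \<ge> 0\<close> by simp
  ultimately obtain g where g: "g \<in> K \<times> cball 0 R"
    and gmin: "\<And>h. h \<in> K \<times> cball 0 R \<Longrightarrow> ?F g \<le> ?F h"
    using continuous_attains_inf[OF _ _ cont] by (metis empty_iff)
  have "?F g \<le> ?F h" if "h \<in> K \<times> UNIV" for h
  proof (cases "norm (snd h) \<le> R")
    case True
    then show ?thesis using that by (intro gmin) (auto simp: mem_Times_iff)
  next
    case False
    have eq: "column j (affine_act_columns h A - B) = snd h + (fst h *v column j A - column j B)"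
      by (simp add: vec_eq_iff column_def affine_act_columns_def affine_act_def)
    have "norm (snd h) - norm (fst h *v column j A - column j B)
            \<le> norm (snd h + (fst h *v column j A - column j B))"
      by (rule norm_diff_ineq)
    also have "\<dots> \<le> ?F h" unfolding eq[symmetric] by (rule col)
    finally have "?F (P0, 0) \<le> ?F h"
      using M[of "fst h"] that False unfolding R_def by (auto simp: mem_Times_iff)
    moreover have "?F g \<le> ?F (P0, 0)"
      using gmin[OF \<open>(P0, 0) \<in> K \<times> cball (0::'a^'n) R\<close>] .
    ultimately show ?thesis by linarith
  qed
  then show ?thesis using g by (intro bexI[of _ g] orbit_dist_eq_min) (auto simp: mem_Times_iff)
qed

lemma orbit_dist_attained:
  fixes A B :: "real^'l^'n" and C D :: "complex^'l^'n"
  shows "\<exists>g\<in>orthogonal_group. orbit_dist orthogonal_group (**) A B = norm (g ** A - B)"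
    and "\<exists>g\<in>real_euclidean_group. orbit_dist real_euclidean_group affine_act_columns A B
             = norm (affine_act_columns g A - B)"
    and "\<exists>g\<in>unitary_group. orbit_dist unitary_group (**) C D = norm (g ** C - D)"
    and "\<exists>g\<in>complex_euclidean_group. orbit_dist complex_euclidean_group affine_act_columns C D
             = norm (affine_act_columns g C - D)"
proof -
  have o: "(orthogonal_group :: (real^'n^'n) set) \<noteq> {}"
    unfolding orthogonal_group_def using orthogonal_matrix_id by blast
  have adj: "cadjoint (mat 1) = (mat 1 :: complex^'n^'n)"
    by (simp add: cadjoint_def mat_def vec_eq_iff)
  have "unitary_matrix (mat 1 :: complex^'n^'n)"
    unfolding unitary_matrix_def by (simp add: adj)
  then have u: "(unitary_group :: (complex^'n^'n) set) \<noteq> {}"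
    unfolding unitary_group_def by blast
  have E: "real_euclidean_group = (orthogonal_group :: (real^'n^'n) set) \<times> UNIV"
    and F: "complex_euclidean_group = (unitary_group :: (complex^'n^'n) set) \<times> UNIV"
    unfolding real_euclidean_group_def complex_euclidean_group_def
      orthogonal_group_def unitary_group_def by auto
  show "\<exists>g\<in>orthogonal_group. orbit_dist orthogonal_group (**) A B = norm (g ** A - B)"
    by (rule attained_linear[OF compact_orthogonal_group o])
  show "\<exists>g\<in>unitary_group. orbit_dist unitary_group (**) C D = norm (g ** C - D)"
    by (rule attained_linear[OF compact_unitary_group u])
  show "\<exists>g\<in>real_euclidean_group. orbit_dist real_euclidean_group affine_act_columns A B
             = norm (affine_act_columns g A - B)"
    unfolding E by (rule attained_affine[OF compact_orthogonal_group o])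
  show "\<exists>g\<in>complex_euclidean_group. orbit_dist complex_euclidean_group affine_act_columns C D
             = norm (affine_act_columns g C - D)"
    unfolding F by (rule attained_affine[OF compact_unitary_group u])
qed

text \<open>
  Euclidean \<open>m\<close>-space is rendered as \<^typ>\<open>real^'m\<close> with \<open>CARD('m) = m\<close>, which forces \<open>m \<ge> 1\<close>.
  The only target dimension this affects is \<open>4 * n * (l - n - 1)\<close>, which for \<open>l \<ge> 2 * n\<close> and
  \<open>n \<ge> 1\<close> vanishes exactly when \<open>n = 1\<close> and \<open>l = 2\<close>. No bi-Lipschitz map into a one-point space
  exists in that case, because the orbit distance is not identically zero.
\<close>

end

theory Submission
  imports Defs
begin

text \<open>
  Write a singular value decomposition \<open>A = Q D W\<close> with \<open>Q\<close> unitary and the rows of \<open>W\<close> orthonormal.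
  The positive semidefinite matrix \<open>S = W\<^sup>* D W\<close> is the square root of \<open>A\<^sup>* A\<close>, and \<open>A \<mapsto> S\<close> is
  bi-Lipschitz for the orbit distance: expanding both \<open>\<parallel>S - S'\<parallel>\<^sup>2\<close> and \<open>\<parallel>P A - A'\<parallel>\<^sup>2\<close> in the singular
  vectors reduces the two inequalities to the trivial estimate \<open>2 x y \<le> x\<^sup>2 + y\<^sup>2\<close> and to
  \<open>Re tr(K D) \<le> tr D\<close> for a contraction \<open>K\<close>.

  A difference \<open>S - S'\<close> has rank at most \<open>r = 2 n\<close>. The target dimension is reached by a linear map
  on Hermitian matrices whose kernel meets the matrices of rank at most \<open>r\<close> only in \<open>0\<close>: it takes the
  first \<open>r\<close> power sums \<open>\<Sum>\<^sub>i i\<^sup>j x\<^sub>i\<^sub>,\<^sub>i\<^sub>+\<^sub>k\<close> along each diagonal \<open>k\<close>. Indeed, the outermost nonzero diagonal of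
  a matrix of rank at most \<open>r\<close> is the diagonal of a triangular submatrix, so it has at most \<open>r\<close> nonzero
  entries, and these vanish by Vandermonde. By compactness the linear map is bounded below on
  such matrices.

  The translations in the affine groups are removed by subtracting one column from all the others,
  which leaves \<open>l - 1\<close> columns. If \<open>l = 2 n\<close> in the complex affine case, all \<open>(l - 1)\<^sup>2\<close> real
  coordinates would be needed; one is saved because \<open>S - S'\<close> is never a nonzero multiple of the
  identity when both matrices are singular.
\<close>

section \<open>Conjugation and adjoints over the real and complex field\<close>

text \<open>
  One class covers \<open>real\<close> (with trivial conjugation) and \<open>complex\<close>; \<open>inner x 1\<close> plays the role of the
  real part. The axioms use \<open>*\<^sub>R\<close> since \<open>of_real\<close> is not available inside a class definition.
\<close>

class conj_field = real_normed_field + euclidean_space +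
  fixes conjugate :: "'a \<Rightarrow> 'a"
  assumes conj_add: "conjugate (x + y) = conjugate x + conjugate y"
    and conj_mult: "conjugate (x * y) = conjugate x * conjugate y"
    and conj_conj [simp]: "conjugate (conjugate x) = x"
    and conj_scaleR_1: "conjugate (r *\<^sub>R 1) = r *\<^sub>R 1"
    and mult_conj_scaleR: "x * conjugate x = (norm x)\<^sup>2 *\<^sub>R 1"
    and inner_conj: "inner x y = inner (x * conjugate y) 1"

instantiation real :: conj_field
begin
definition conjugate_real :: "real \<Rightarrow> real" where "conjugate_real x = x"
instance by standard (auto simp: conjugate_real_def power2_eq_square)
end

instantiation complex :: conj_field
begin
definition conjugate_complex :: "complex \<Rightarrow> complex" where "conjugate_complex x = cnj x"
instance
  by standard (auto simp: conjugate_complex_def complex_eq_iff inner_complex_def cmod_power2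
      simp flip: power2_eq_square)
end

lemma conj_of_real [simp]: "conjugate (of_real r :: 'a::conj_field) = of_real r"
  by (simp add: of_real_def conj_scaleR_1)

lemma mult_conj: "x * conjugate x = (of_real ((norm x)\<^sup>2) :: 'a::conj_field)"
  unfolding of_real_def by (rule mult_conj_scaleR)

lemma conj_0 [simp]: "conjugate (0::'a::conj_field) = 0"
  using conj_of_real[of 0, where 'a='a] by simp

lemma conj_1 [simp]: "conjugate (1::'a::conj_field) = 1"
  using conj_of_real[of 1, where 'a='a] by simp

lemma conj_sum: "conjugate (\<Sum>i\<in>I. f i :: 'a::conj_field) = (\<Sum>i\<in>I. conjugate (f i))"
  by (induction I rule: infinite_finite_induct) (auto simp: conj_add)

lemma conj_diff: "conjugate (x - y) = conjugate x - conjugate (y::'a::conj_field)"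
  using conj_add[of "x - y" y] by (simp add: algebra_simps)

lemma conj_of_nat [simp]: "conjugate (of_nat k :: 'a::conj_field) = of_nat k"
  using conj_of_real[of "real k", where 'a='a] by simp

lemma norm_conj [simp]: "norm (conjugate (x::'a::conj_field)) = norm x"
proof -
  have "of_real ((norm (conjugate x))\<^sup>2) = (of_real ((norm x)\<^sup>2) :: 'a)"
    by (metis conj_conj mult.commute mult_conj)
  then show ?thesis by (simp add: power2_eq_iff_nonneg del: of_real_power)
qed

lemma continuous_on_conj [continuous_intros]:
  assumes "continuous_on S f"
  shows "continuous_on S (\<lambda>x. conjugate (f x :: 'a::conj_field))"
proof -
  have "bounded_linear (conjugate :: 'a \<Rightarrow> 'a)"
    by (rule bounded_linear_intro[where K = 1])
      (simp_all add: conj_add scaleR_conv_of_real conj_mult)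
  from bounded_linear.continuous_on[OF this assms] show ?thesis .
qed

lemma inner_of_real_1: "inner (of_real r * x) (1::'a::conj_field) = r * inner x 1"
  by (simp flip: scaleR_conv_of_real)

lemma inner_1_1: "inner 1 (1::'a::conj_field) = 1"
  by (simp flip: power2_norm_eq_inner)

text \<open>A self-conjugate \<open>x\<close> satisfies \<open>x * x = x * conjugate x\<close>, the
  square of its norm, so \<open>x\<close> is plus or minus its norm. It is therefore real, and
  determined by its real part.\<close>

lemma conj_invariant_eq_0:
  fixes x :: "'a::conj_field"
  assumes "conjugate x = x" "inner x 1 = 0"
  shows "x = 0"
proof -
  have "x * x = of_real (norm x) * of_real (norm x)"
    using mult_conj[of x] assms by (simp add: power2_eq_square)
  then have "x = of_real (norm x) \<or> x = of_real (- norm x)"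
    by (simp add: square_eq_iff)
  then obtain r where r: "x = of_real r" by blast
  then show ?thesis using assms(2) inner_of_real_1[of r "1::'a"] by (simp add: inner_1_1)
qed

section \<open>Adjoints, unitary matrices and real diagonal matrices\<close>

definition adj :: "'a::conj_field^'n^'m \<Rightarrow> 'a^'m^'n" where
  "adj A = (\<chi> i j. conjugate (A $ j $ i))"

definition unit_mat :: "'a::conj_field^'n^'n \<Rightarrow> bool" where
  "unit_mat P \<longleftrightarrow> P ** adj P = mat 1"

definition diag :: "('n \<Rightarrow> real) \<Rightarrow> 'a::conj_field^'n^'n" where
  "diag d = (\<chi> i j. if i = j then of_real (d i) else 0)"

lemma adj_adj [simp]: "adj (adj A) = A"
  by (simp add: adj_def vec_eq_iff)

lemma adj_mult: "adj (A ** B) = adj B ** adj A"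
  by (simp add: adj_def matrix_matrix_mult_def vec_eq_iff conj_sum conj_mult mult.commute)

lemma adj_diag [simp]: "adj (diag d) = diag d"
  by (auto simp: adj_def diag_def vec_eq_iff)

lemma diag_mult: "(diag d ** A) $ i $ j = of_real (d i) * A $ i $ j"
  by (simp add: diag_def matrix_matrix_mult_def if_distrib if_distribR cong: if_cong)

lemma unit_mat_adj: "unit_mat (adj P) \<longleftrightarrow> unit_mat P"
  by (simp add: unit_mat_def matrix_left_right_inverse)

lemma unit_mat_left: "unit_mat P \<Longrightarrow> adj P ** P = mat 1"
  by (simp add: unit_mat_def matrix_left_right_inverse)

lemma unit_mat_mult: "unit_mat P \<Longrightarrow> unit_mat Q \<Longrightarrow> unit_mat (P ** Q)"
  unfolding unit_mat_def adj_mult by (metis matrix_mul_assoc matrix_mul_rid)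

lemma inner_mat: "inner A B = inner (trace (A ** adj B)) 1"
  for A B :: "'a::conj_field^'l^'n"
  by (simp add: trace_def matrix_matrix_mult_def adj_def inner_vec_def inner_sum_left
      flip: inner_conj)

lemma inner_vec_conj: "inner x y = inner (\<Sum>i\<in>UNIV. x $ i * conjugate (y $ i)) 1"
  for x y :: "'a::conj_field^'l"
  by (simp add: inner_vec_def inner_sum_left flip: inner_conj)

section \<open>Homogeneous linear systems with fewer equations than unknowns\<close>

text \<open>Gaussian elimination, one equation at a time: equation \<open>t\<close> is solved for an
  unknown \<open>k\<close> that occurs in it, and the induction hypothesis is applied to the other
  equations with \<open>k\<close> eliminated.\<close>

lemma homogeneous_solution:
  fixes p :: "'i \<Rightarrow> 't \<Rightarrow> 'a::field"
  assumes "finite T" "finite I" "card T < card I"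
  shows "\<exists>c. (\<exists>i\<in>I. c i \<noteq> 0) \<and> (\<forall>i. i \<notin> I \<longrightarrow> c i = 0) \<and> (\<forall>t\<in>T. (\<Sum>i\<in>I. c i * p i t) = 0)"
  using assms
proof (induction T arbitrary: I p rule: finite_induct)
  case empty
  then obtain i where "i \<in> I" by fastforce
  then show ?case by (intro exI[of _ "\<lambda>j. if j = i then 1 else 0"]) auto
next
  case (insert t T)
  show ?case
  proof (cases "\<forall>i\<in>I. p i t = 0")
    case True
    have "card T < card I" using insert by simp
    from insert.IH[OF insert.prems(1) this, of p] True show ?thesis by auto
  next
    case False
    then obtain k where k: "k \<in> I" "p k t \<noteq> 0" by blast
    have "card T < card (I - {k})" using insert k by simp
    from insert.IH[OF _ this, of "\<lambda>i s. p i s - p i t / p k t * p k s"] insert.prems(1)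
    obtain c where c: "\<exists>i\<in>I - {k}. c i \<noteq> 0" "\<forall>i. i \<notin> I - {k} \<longrightarrow> c i = 0"
      "\<forall>s\<in>T. (\<Sum>i\<in>I - {k}. c i * (p i s - p i t / p k t * p k s)) = 0"
      by auto
    \<comment> \<open>The value of the unknown \<open>k\<close> that equation \<open>t\<close>
      forces.\<close>
    define e where "e = - (\<Sum>i\<in>I - {k}. c i * p i t) / p k t"
    have sum: "(\<Sum>i\<in>I. (c(k := e)) i * p i s) = e * p k s + (\<Sum>i\<in>I - {k}. c i * p i s)" for s
      using k insert.prems(1) by (subst sum.remove[of I k]) (auto intro!: sum.cong)
    have red: "(\<Sum>i\<in>I - {k}. c i * (p i s - p i t / p k t * p k s))
        = (\<Sum>i\<in>I - {k}. c i * p i s) + e * p k s" for s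
      unfolding e_def
      by (simp add: right_diff_distrib sum_subtractf sum_distrib_right sum_divide_distrib)
        (simp add: mult.assoc)
    have "(\<Sum>i\<in>I. (c(k := e)) i * p i t) = 0"
      unfolding sum using k(2) by (simp add: e_def)
    moreover have "(\<Sum>i\<in>I. (c(k := e)) i * p i s) = 0" if "s \<in> T" for s
      using bspec[OF c(3) that] unfolding sum red by (simp only: add.commute)
    ultimately have "\<forall>s\<in>insert t T. (\<Sum>i\<in>I. (c(k := e)) i * p i s) = 0" by blast
    moreover have "\<exists>i\<in>I. (c(k := e)) i \<noteq> 0" using c(1) by auto
    moreover have "\<forall>i. i \<notin> I \<longrightarrow> (c(k := e)) i = 0" using c(2) k by auto
    ultimately show ?thesis by blast
  qed
qed

lemma unit_vector_in_kernel:
  fixes p :: "'l::finite \<Rightarrow> 't \<Rightarrow> 'a::conj_field"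
  assumes "finite T" "card T < card I"
  shows "\<exists>c::'a^'l. norm c = 1 \<and> (\<forall>i. i \<notin> I \<longrightarrow> c $ i = 0) \<and>
    (\<forall>t\<in>T. (\<Sum>i\<in>UNIV. c $ i * p i t) = 0)"
proof -
  from homogeneous_solution[OF assms(1) _ assms(2), of p] obtain c where
    c: "\<exists>i\<in>I. c i \<noteq> 0" "\<forall>i. i \<notin> I \<longrightarrow> c i = 0" "\<forall>t\<in>T. (\<Sum>i\<in>I. c i * p i t) = 0"
    by auto
  define v :: "'a^'l" where "v = (\<chi> i. c i)"
  have v: "v \<noteq> 0" using c(1) by (auto simp: v_def vec_eq_iff)
  have "(\<Sum>i\<in>UNIV. c i * p i t) = (\<Sum>i\<in>I. c i * p i t)" for t
    by (rule sum.mono_neutral_right) (use c(2) in auto)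
  then have "(\<Sum>i\<in>UNIV. (v /\<^sub>R norm v) $ i * p i t) = 0" if "t \<in> T" for t
    using c(3) that by (simp add: v_def flip: scaleR_right.sum)
  moreover have "norm (v /\<^sub>R norm v) = 1" using v by simp
  moreover have "\<forall>i. i \<notin> I \<longrightarrow> (v /\<^sub>R norm v) $ i = 0" using c(2) by (simp add: v_def)
  ultimately show ?thesis by blast
qed

section \<open>Singular value decomposition\<close>

text \<open>The Hermitian inner product, linear in the first argument. Orthogonality over the
  complex field needs it in full; \<open>inner\<close> is only its real part.\<close>

definition hip :: "'a::conj_field^'l \<Rightarrow> 'a^'l \<Rightarrow> 'a" where
  "hip x y = (\<Sum>i\<in>UNIV. x $ i * conjugate (y $ i))"

lemma inner_eq_hip: "inner x y = inner (hip x y) 1"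
  unfolding hip_def by (rule inner_vec_conj)

lemma hip_self: "hip x x = of_real ((norm x)\<^sup>2)"
  by (simp add: hip_def mult_conj norm_vec_def L2_set_def sum_nonneg del: of_real_power
      flip: of_real_sum)

lemma conj_hip: "conjugate (hip x y) = hip y x"
  by (simp add: hip_def conj_sum conj_mult mult.commute)

lemma hip_scaleR_right: "hip x (r *\<^sub>R y) = of_real r * hip x y"
  unfolding hip_def vector_scaleR_component
  by (simp add: scaleR_conv_of_real conj_mult sum_distrib_left mult_ac)

lemma hip_scaleR_left: "hip (r *\<^sub>R x) y = of_real r * hip x y"
  unfolding hip_def vector_scaleR_component
  by (simp add: scaleR_conv_of_real sum_distrib_left mult_ac)

lemma hip_adj: "hip (A *v x) y = hip x (adj A *v y)"
  by (simp add: hip_def adj_def matrix_vector_mult_def sum_distrib_left sum_distrib_right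
      conj_sum conj_mult mult_ac) (rule sum.swap)

text \<open>The single competitor \<open>x /\<^sub>R norm x\<close> already forces
  \<open>norm x \<le> inner w x\<close>, which is the equality case of Cauchy-Schwarz.\<close>

lemma unit_maximiser_eq:
  fixes w x :: "'v::real_inner"
  assumes "norm w = 1" and max: "x \<noteq> 0 \<Longrightarrow> inner (x /\<^sub>R norm x) x \<le> inner w x"
  shows "x = inner w x *\<^sub>R w" and "inner w x \<ge> 0"
proof -
  have eq: "inner w x = norm x"
  proof (cases "x = 0")
    case False
    have "norm x \<le> inner w x" using max[OF False] False
      by (simp add: power2_norm_eq_inner[symmetric] power2_eq_square flip: mult.assoc)
    then show ?thesis using norm_cauchy_schwarz[of w x] assms(1) by simp
  qed simp
  have "(norm (x - norm x *\<^sub>R w))\<^sup>2 = 0"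
    unfolding power2_norm_eq_inner inner_diff_left inner_diff_right
    using eq assms(1)
    by (simp add: inner_commute[of x w] norm_eq_1)
      (simp add: power2_norm_eq_inner[symmetric] power2_eq_square)
  then show "x = inner w x *\<^sub>R w" using eq by simp
  show "inner w x \<ge> 0" using eq by simp
qed

text \<open>
  The induction step adds a pair \<open>w\<close>, \<open>b\<close> of unit vectors, orthogonal to the previous ones, that
  maximises \<open>inner (A *v w) b\<close>: the equality case of Cauchy-Schwarz makes it a singular pair.
\<close>

lemma singular_vectors:
  fixes A :: "'a::conj_field^'l^'n" and I :: "'n set"
  assumes "CARD('n) \<le> CARD('l)"
  shows "\<exists>(u :: 'n \<Rightarrow> 'a^'l) (a :: 'n \<Rightarrow> 'a^'n) s.
    (\<forall>i\<in>I. s i \<ge> 0 \<and> A *v u i = s i *\<^sub>R a i \<and> adj A *v a i = s i *\<^sub>R u i) \<and>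
    (\<forall>i\<in>I. \<forall>j\<in>I. hip (u i) (u j) = (if i = j then 1 else 0)) \<and>
    (\<forall>i\<in>I. \<forall>j\<in>I. hip (a i) (a j) = (if i = j then 1 else 0))"
  using finite[of I]
proof (induction I rule: finite_induct)
  case empty
  show ?case by simp
next
  case (insert k I)
  then obtain u :: "'n \<Rightarrow> 'a^'l" and a :: "'n \<Rightarrow> 'a^'n" and s where
    s: "\<And>i. i \<in> I \<Longrightarrow> s i \<ge> 0 \<and> A *v u i = s i *\<^sub>R a i \<and> adj A *v a i = s i *\<^sub>R u i" and
    u: "\<And>i j. i \<in> I \<Longrightarrow> j \<in> I \<Longrightarrow> hip (u i) (u j) = (if i = j then 1 else 0)" and
    a: "\<And>i j. i \<in> I \<Longrightarrow> j \<in> I \<Longrightarrow> hip (a i) (a j) = (if i = j then 1 else 0)"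
    by blast
  define U where "U = {w. norm w = 1 \<and> (\<forall>i\<in>I. hip w (u i) = 0)}"
  define V where "V = {b. norm b = 1 \<and> (\<forall>i\<in>I. hip b (a i) = 0)}"
  have "card I < card (insert k I)" using insert by simp
  \<comment> \<open>Fewer than \<open>CARD('n)\<close> orthogonality conditions leave room for a
    further unit vector, in dimension \<open>CARD('n)\<close> and hence also in dimension
    \<open>CARD('l)\<close>.\<close>
  then have I: "card I < CARD('n)" using card_mono[of UNIV "insert k I"] by simp
  have closed: "closed {w. norm w = 1 \<and> (\<forall>i\<in>I. hip w (f i) = 0)}"
    for f :: "'n \<Rightarrow> 'a^'m::finite"
    unfolding hip_def Ball_def
    by (intro closed_Collect_conj closed_Collect_all closed_Collect_imp closed_Collect_eq
        continuous_intros) auto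
  have bd: "bounded {w. norm w = 1 \<and> (\<forall>i\<in>I. hip w (f i) = 0)}"
    for f :: "'n \<Rightarrow> 'a^'m::finite"
    unfolding bounded_iff by (intro exI[of _ 1]) auto
  have "compact U" "compact V"
    unfolding U_def V_def by (auto simp: compact_eq_bounded_closed closed bd)
  then have compact: "compact (U \<times> V)" by (rule compact_Times)
  have "U \<noteq> {}"
    using unit_vector_in_kernel[of I UNIV "\<lambda>j i. conjugate (u i $ j)"] I assms
    by (auto simp: U_def hip_def)
  moreover have "V \<noteq> {}"
    using unit_vector_in_kernel[of I UNIV "\<lambda>j i. conjugate (a i $ j)"] I
    by (auto simp: V_def hip_def)
  ultimately have "U \<times> V \<noteq> {}" by simp
  moreover have "continuous_on (U \<times> V) (\<lambda>z. inner (A *v fst z) (snd z))"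
    unfolding matrix_vector_mult_def by (intro continuous_intros)
  ultimately obtain z where z: "z \<in> U \<times> V"
    "\<And>y. y \<in> U \<times> V \<Longrightarrow> inner (A *v fst y) (snd y) \<le> inner (A *v fst z) (snd z)"
    using continuous_attains_sup[OF compact] by blast
  define w where "w = fst z"
  define b where "b = snd z"
  have w: "w \<in> U" and b: "b \<in> V" using z(1) by (auto simp: w_def b_def)
  have max: "inner (A *v w') b' \<le> inner (A *v w) b" if "w' \<in> U" "b' \<in> V" for w' b'
    using z(2)[of "(w', b')"] that by (simp add: w_def b_def)
  have adjA: "inner (A *v w') b' = inner w' (adj A *v b')" for w' b'
    by (simp add: inner_eq_hip hip_adj)
  define t where "t = inner (A *v w) b"
  have "adj A *v b = t *\<^sub>R w \<and> t \<ge> 0"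
  proof -
    \<comment> \<open>Since \<open>A *v u i\<close> is a multiple of \<open>a i\<close> and
      \<open>b\<close> is orthogonal to \<open>a i\<close>, the normalised vector
      \<open>adj A *v b\<close> is an admissible competitor of \<open>w\<close>.\<close>
    have "hip (adj A *v b) (u i) = 0" if "i \<in> I" for i
      using hip_adj[of "adj A" b "u i"] s[OF that] b that
      by (simp add: V_def hip_scaleR_right)
    then have "(adj A *v b) /\<^sub>R norm (adj A *v b) \<in> U" if "adj A *v b \<noteq> 0"
      using that by (simp add: U_def hip_scaleR_left)
    then have "inner ((adj A *v b) /\<^sub>R norm (adj A *v b)) (adj A *v b) \<le> inner w (adj A *v b)"
      if "adj A *v b \<noteq> 0"
      using max[OF _ b] that unfolding adjA by blast
    from unit_maximiser_eq[OF _ this] w show ?thesis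
      unfolding t_def adjA by (simp add: U_def)
  qed
  moreover have "A *v w = t *\<^sub>R b"
  proof -
    have "hip (A *v w) (a i) = 0" if "i \<in> I" for i
      using s[OF that] w that by (simp add: hip_adj U_def hip_scaleR_right)
    then have "(A *v w) /\<^sub>R norm (A *v w) \<in> V" if "A *v w \<noteq> 0"
      using that by (simp add: V_def hip_scaleR_left)
    then have "inner ((A *v w) /\<^sub>R norm (A *v w)) (A *v w) \<le> inner b (A *v w)"
      if "A *v w \<noteq> 0"
      using max[OF w] that by (metis inner_commute)
    from unit_maximiser_eq(1)[OF _ this] b show ?thesis
      unfolding t_def by (simp add: V_def inner_commute)
  qed
  moreover have "hip w w = 1" "hip b b = 1" using w b by (auto simp: hip_self U_def V_def)
  moreover have "hip w (u i) = 0" "hip (u i) w = 0" "hip b (a i) = 0" "hip (a i) b = 0"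
    if "i \<in> I" for i
    using w b that conj_hip[of w "u i"] conj_hip[of b "a i"] by (auto simp: U_def V_def)
  ultimately show ?case
    using insert.hyps(2) s u a
    by (intro exI[of _ "u(k := w)"] exI[of _ "a(k := b)"] exI[of _ "s(k := t)"]) auto
qed

text \<open>The thin decomposition: \<open>W\<close> has the shape of \<open>A\<close> and
  orthonormal rows, and the singular values are unordered and may vanish.\<close>

definition svd :: "'a::conj_field^'l^'n \<Rightarrow> 'a^'n^'n \<Rightarrow> ('n \<Rightarrow> real) \<Rightarrow> 'a^'l^'n \<Rightarrow> bool" where
  "svd A Q d W \<longleftrightarrow>
     unit_mat Q \<and> (\<forall>i. d i \<ge> 0) \<and> W ** adj W = mat 1 \<and> A = Q ** diag d ** W"

text \<open>The vectors \<open>a t\<close> become the columns of \<open>Q\<close> and the conjugates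
  of \<open>u t\<close> the rows of \<open>W\<close>. The relations
  \<open>adj A *v a t = s t *\<^sub>R u t\<close>, conjugated, are then the rows of
  \<open>adj Q ** A = diag s ** W\<close>.\<close>

lemma svd_exists:
  fixes A :: "'a::conj_field^'l^'n"
  assumes "CARD('n) \<le> CARD('l)"
  shows "\<exists>Q d W. svd A Q d W"
proof -
  from singular_vectors[OF assms, of UNIV A]
  obtain u :: "'n \<Rightarrow> 'a^'l" and a :: "'n \<Rightarrow> 'a^'n" and s where
    s: "\<And>i. s i \<ge> 0" "\<And>i. adj A *v a i = s i *\<^sub>R u i" and
    u: "\<And>i j. hip (u i) (u j) = (if i = j then 1 else 0)" and
    a: "\<And>i j. hip (a i) (a j) = (if i = j then 1 else 0)"
    by blast
  define Q :: "'a^'n^'n" where "Q = (\<chi> i t. a t $ i)"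
  define W :: "'a^'l^'n" where "W = (\<chi> t j. conjugate (u t $ j))"
  have "(adj Q ** Q) $ i $ j = hip (a j) (a i)" for i j
    by (simp add: adj_def Q_def matrix_matrix_mult_def hip_def mult.commute)
  then have "adj Q ** Q = mat 1" by (auto simp: vec_eq_iff a mat_def)
  then have Q: "unit_mat Q" by (simp add: unit_mat_def matrix_left_right_inverse)
  have "(W ** adj W) $ i $ j = hip (u j) (u i)" for i j
    by (simp add: adj_def W_def matrix_matrix_mult_def hip_def mult.commute)
  then have W: "W ** adj W = mat 1" by (auto simp: vec_eq_iff u mat_def)
  have "(adj Q ** A) $ t $ j = conjugate ((adj A *v a t) $ j)" for t j
    by (simp add: adj_def Q_def matrix_matrix_mult_def matrix_vector_mult_def conj_sum conj_mult
        mult.commute)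
  then have "(adj Q ** A) $ t $ j = (diag s ** W) $ t $ j" for t j
    unfolding diag_mult s vector_scaleR_component
    by (simp add: W_def scaleR_conv_of_real conj_mult)
  then have "adj Q ** A = diag s ** W" by (simp add: vec_eq_iff)
  then have "A = Q ** diag s ** W"
    using Q unfolding unit_mat_def by (metis matrix_mul_assoc matrix_mul_lid)
  with Q W s(1) show ?thesis unfolding svd_def by blast
qed

section \<open>Lipschitz estimates for the square root of the Gram matrix\<close>

lemma mult_diag: "(A ** diag d) $ i $ j = A $ i $ j * of_real (d j)"
  by (simp add: diag_def matrix_matrix_mult_def if_distrib cong: if_cong)

lemma trace_diag_mult: "trace (diag d ** A) = (\<Sum>i\<in>UNIV. of_real (d i) * A $ i $ i)"
  by (simp add: trace_def diag_mult)

text \<open>Cyclicity of the trace separates the overlaps of the right factors from those of the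
  left factors. Taking a unitary left factor gives \<open>inner A B\<close>; taking
  \<open>adj W\<close> gives the inner product of the roots.\<close>

lemma inner_diag_products:
  fixes X :: "'a::conj_field^'n^'k" and X' :: "'a^'m^'k" and W :: "'a^'l^'n" and W' :: "'a^'l^'m"
  shows "inner (X ** diag d ** W) (X' ** diag d' ** W') =
    (\<Sum>i\<in>UNIV. \<Sum>j\<in>UNIV. d i * d' j * inner ((W ** adj W') $ i $ j * (adj X' ** X) $ j $ i) 1)"
proof -
  have "trace ((X ** diag d ** W) ** adj (X' ** diag d' ** W'))
      = trace (X ** (diag d ** (W ** adj W') ** diag d' ** adj X'))"
    by (simp add: adj_mult matrix_mul_assoc)
  also have "\<dots> = trace ((diag d ** (W ** adj W') ** diag d') ** (adj X' ** X))"
    by (subst trace_mul_sym) (simp add: matrix_mul_assoc)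
  also have "\<dots> = (\<Sum>i\<in>UNIV. \<Sum>j\<in>UNIV.
      of_real (d i * d' j) * ((W ** adj W') $ i $ j * (adj X' ** X) $ j $ i))"
    unfolding trace_def matrix_matrix_mult_def[of _ "adj X' ** X"] vec_lambda_beta mult_diag diag_mult
    by (simp add: mult_ac)
  finally show ?thesis
    unfolding inner_mat[of "X ** diag d ** W"]
    by (simp only: inner_sum_left inner_of_real_1)
qed

lemma unit_mat_row_norm:
  assumes "unit_mat G"
  shows "(\<Sum>j\<in>UNIV. (norm (G $ i $ j))\<^sup>2) = 1"
proof -
  have "of_real (\<Sum>j\<in>UNIV. (norm (G $ i $ j))\<^sup>2) = (G ** adj G) $ i $ i"
    by (simp add: matrix_matrix_mult_def adj_def mult_conj)
  also have "\<dots> = of_real 1" using assms by (simp add: unit_mat_def mat_def)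
  finally show ?thesis by (simp only: of_real_eq_iff)
qed

lemma unit_mat_column_norm:
  assumes "unit_mat G"
  shows "(\<Sum>j\<in>UNIV. (norm (G $ j $ i))\<^sup>2) = 1"
  using unit_mat_row_norm[OF iffD2[OF unit_mat_adj assms], of i] by (simp add: adj_def)

text \<open>The left factor \<open>Q\<close> does not enter, which makes the root constant on
  orbits.\<close>

definition gram_root :: "('n \<Rightarrow> real) \<Rightarrow> 'a::conj_field^'l^'n \<Rightarrow> 'a^'l^'l" where
  "gram_root d W = adj W ** diag d ** W"

lemma inner_svd:
  assumes "svd A Q d W" "svd B Q' d' W'"
  shows "inner A B = (\<Sum>i\<in>UNIV. \<Sum>j\<in>UNIV.
    d i * d' j * inner ((W ** adj W') $ i $ j * (adj Q' ** Q) $ j $ i) 1)"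
  using assms by (simp add: svd_def inner_diag_products)

lemma inner_gram_root:
  "inner (gram_root d W) (gram_root d' W') =
    (\<Sum>i\<in>UNIV. \<Sum>j\<in>UNIV. d i * d' j * (norm ((W ** adj W') $ i $ j))\<^sup>2)"
proof -
  have "(W' ** adj W) $ j $ i = conjugate ((W ** adj W') $ i $ j)" for i j
    by (simp add: matrix_matrix_mult_def adj_def conj_sum conj_mult mult.commute)
  moreover have "inner (of_real r) (1::'a) = r" for r
    using inner_of_real_1[of r "1::'a"] by (simp add: inner_1_1)
  ultimately show ?thesis
    unfolding gram_root_def inner_diag_products adj_adj
    by (simp add: mult_conj del: of_real_power)
qed

lemma norm_gram_root:
  assumes "W ** adj W = mat 1"
  shows "(norm (gram_root d W))\<^sup>2 = (\<Sum>i\<in>UNIV. (d i)\<^sup>2)"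
  unfolding power2_norm_eq_inner inner_gram_root assms
  by (simp add: mat_def if_distrib inner_1_1 power2_eq_square cong: if_cong)

text \<open>Together with \<open>norm_gram_root\<close> this reduces the comparison of distances to
  a comparison of inner products.\<close>

lemma norm_svd:
  assumes "svd A Q d W"
  shows "(norm A)\<^sup>2 = (\<Sum>i\<in>UNIV. (d i)\<^sup>2)"
proof -
  have "W ** adj W = mat 1" "adj Q ** Q = mat 1"
    using assms unit_mat_left by (auto simp: svd_def)
  then show ?thesis
    unfolding power2_norm_eq_inner inner_svd[OF assms assms]
    by (simp add: mat_def if_distrib if_distribR inner_1_1 power2_eq_square cong: if_cong)
qed

lemma power2_norm_diff: "(norm (x - y))\<^sup>2 = (norm x)\<^sup>2 + (norm y)\<^sup>2 - 2 * inner x y"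
  for x y :: "'v::real_inner"
  unfolding power2_norm_eq_inner inner_diff_left inner_diff_right
  by (simp add: inner_commute)

text \<open>After cancelling norms the claim is that \<open>2 * inner A B\<close> is at most the
  inner product of the roots plus half the sum of all squared singular values. Each product
  \<open>K $ i $ j * G $ j $ i\<close> is split by the arithmetic-geometric mean: the
  \<open>K\<close> part gives the roots, the \<open>G\<close> part the squares.\<close>

lemma norm_gram_root_diff_le:
  assumes A: "svd A Q d W" and B: "svd B Q' d' W'"
  shows "norm (gram_root d W - gram_root d' W') \<le> sqrt 2 * norm (A - B)"
proof -
  define G where "G = adj Q' ** Q"
  define K where "K = W ** adj W'"
  have G: "unit_mat G"
    using A B unfolding G_def svd_def by (intro unit_mat_mult) (auto simp: unit_mat_adj)
  have d: "d i \<ge> 0" "d' i \<ge> 0" for i using A B by (auto simp: svd_def)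
  let ?\<alpha> = "\<Sum>i\<in>UNIV. (d i)\<^sup>2" and ?\<beta> = "\<Sum>i\<in>UNIV. (d' i)\<^sup>2"
  let ?g = "\<Sum>i\<in>UNIV. \<Sum>j\<in>UNIV. d i * d' j * (norm (G $ j $ i))\<^sup>2"
  \<comment> \<open>The squared absolute values of the entries of the unitary matrix
    \<open>G\<close> have row and column sums 1.\<close>
  have "?g \<le> (\<Sum>i\<in>UNIV. \<Sum>j\<in>UNIV. ((d i)\<^sup>2 / 2 + (d' j)\<^sup>2 / 2) * (norm (G $ j $ i))\<^sup>2)"
    by (intro sum_mono mult_right_mono) (use sum_squares_bound in \<open>auto simp: field_simps\<close>)
  also have "\<dots> = (\<Sum>i\<in>UNIV. \<Sum>j\<in>UNIV. (d i)\<^sup>2 / 2 * (norm (G $ j $ i))\<^sup>2)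
      + (\<Sum>j\<in>UNIV. \<Sum>i\<in>UNIV. (d' j)\<^sup>2 / 2 * (norm (G $ j $ i))\<^sup>2)"
    by (subst (3) sum.swap) (simp add: distrib_right sum.distrib)
  also have "\<dots> = (?\<alpha> + ?\<beta>) / 2"
    unfolding sum_distrib_left[symmetric] unit_mat_row_norm[OF G] unit_mat_column_norm[OF G]
    by (simp add: add_divide_distrib sum_divide_distrib)
  finally have g: "?g \<le> (?\<alpha> + ?\<beta>) / 2" .
  have "inner (x * y) 1 \<le> ((norm x)\<^sup>2 + (norm y)\<^sup>2) / 2" for x y :: 'a
    using norm_cauchy_schwarz[of "x * y" 1] sum_squares_bound[of "norm x" "norm y"]
    by (simp add: norm_mult)
  then have "inner A B \<le> (\<Sum>i\<in>UNIV. \<Sum>j\<in>UNIV.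
      d i * d' j * (((norm (K $ i $ j))\<^sup>2 + (norm (G $ j $ i))\<^sup>2) / 2))"
    unfolding inner_svd[OF A B] G_def K_def by (intro sum_mono mult_left_mono) (simp_all add: d)
  also have "\<dots> = (inner (gram_root d W) (gram_root d' W') + ?g) / 2"
    unfolding inner_gram_root K_def[symmetric]
    by (simp add: sum_divide_distrib distrib_left add_divide_distrib sum.distrib)
  finally have "(norm (gram_root d W - gram_root d' W'))\<^sup>2 \<le> 2 * (norm (A - B))\<^sup>2"
    using g A B unfolding power2_norm_diff norm_svd[OF A] norm_svd[OF B]
    by (simp add: norm_gram_root svd_def)
  then show ?thesis using real_le_rsqrt by (fastforce simp: real_sqrt_mult)
qed

lemma inner_orthonormal_rows_le:
  fixes X Y :: "'a::conj_field^'l^'n"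
  assumes "X ** adj X = mat 1" "Y ** adj Y = mat 1"
  shows "inner ((X ** adj Y) $ i $ i) 1 \<le> 1"
proof -
  have hip: "(Z ** adj Z') $ i $ i = hip (Z $ i) (Z' $ i)" for Z Z' :: "'a^'l^'n"
    by (simp add: matrix_matrix_mult_def adj_def hip_def)
  have "norm (Z $ i) = 1" if "Z ** adj Z = mat 1" for Z :: "'a^'l^'n"
  proof -
    have "of_real ((norm (Z $ i))\<^sup>2) = (of_real 1 :: 'a)"
      unfolding hip_self[symmetric] hip[symmetric] that by (simp add: mat_def)
    then have "(norm (Z $ i))\<^sup>2 = 1" by (simp only: of_real_eq_iff)
    then show ?thesis by (simp add: power2_eq_1_iff) (smt (verit) norm_ge_zero)
  qed
  then show ?thesis
    using norm_cauchy_schwarz[of "X $ i" "Y $ i"] assms by (simp add: hip flip: inner_eq_hip)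
qed

text \<open>The orthogonal Procrustes problem: \<open>P\<close> is chosen so that
  \<open>inner (P ** A) B\<close> is the sum of the singular values of
  \<open>diag d ** K ** diag d'\<close>. The inner product of the roots pairs the same matrix with
  the contraction \<open>adj K\<close> and is no larger.\<close>

lemma norm_orbit_le_gram_root_diff:
  fixes A B :: "'a::conj_field^'l^'n"
  assumes A: "svd A Q d W" and B: "svd B Q' d' W'"
  shows "\<exists>P. unit_mat P \<and> norm (P ** A - B) \<le> norm (gram_root d W - gram_root d' W')"
proof -
  define K where "K = W ** adj W'"
  obtain X e Y where N: "svd (diag d ** K ** diag d') X e Y"
    using svd_exists[of "diag d ** K ** diag d' :: 'a^'n^'n"] by auto
  have Q: "unit_mat Q" "unit_mat Q'" and X: "unit_mat X" and Y: "unit_mat Y"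
    using A B N by (auto simp: svd_def unit_mat_def)
  \<comment> \<open>This turns the left overlap matrix into \<open>adj Y ** adj X\<close>, which
    cancels the unitary factors \<open>X\<close> and \<open>Y\<close>.\<close>
  define P where "P = Q' ** adj Y ** adj X ** adj Q"
  have P: "unit_mat P"
    unfolding P_def by (intro unit_mat_mult) (auto simp: unit_mat_adj Q X Y)
  have PA: "svd (P ** A) (P ** Q) d W"
    using A unit_mat_mult[OF P] by (auto simp: svd_def matrix_mul_assoc)
  have G: "adj Q' ** (P ** Q) = adj Y ** adj X"
    unfolding P_def matrix_mul_assoc unit_mat_left[OF Q(2)] matrix_mul_lid
    by (simp add: unit_mat_left[OF Q(1)] flip: matrix_mul_assoc)
  have N_eq: "diag d ** K ** diag d' = X ** diag e ** Y" using N by (simp add: svd_def)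
  \<comment> \<open>Needed twice: for \<open>L = adj K\<close> and for
    \<open>L = adj Y ** adj X\<close>.\<close>
  have tr: "(\<Sum>i\<in>UNIV. \<Sum>j\<in>UNIV. d i * d' j * inner (K $ i $ j * L $ j $ i) 1)
      = (\<Sum>i\<in>UNIV. e i * inner ((Y ** L ** X) $ i $ i) 1)" for L
  proof -
    have "(\<Sum>i\<in>UNIV. \<Sum>j\<in>UNIV. d i * d' j * inner (K $ i $ j * L $ j $ i) 1)
        = inner (trace ((diag d ** K ** diag d') ** L)) 1"
      unfolding trace_def matrix_matrix_mult_def[of _ L] vec_lambda_beta mult_diag diag_mult
      by (simp add: inner_sum_left mult_ac flip: inner_of_real_1)
    also have "trace ((diag d ** K ** diag d') ** L) = trace (diag e ** (Y ** L ** X))"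
      unfolding N_eq using trace_mul_sym[of X "diag e ** Y ** L"] by (simp add: matrix_mul_assoc)
    finally show ?thesis
      unfolding trace_diag_mult by (simp only: inner_sum_left inner_of_real_1)
  qed
  have "inner (gram_root d W) (gram_root d' W')
      = (\<Sum>i\<in>UNIV. e i * inner ((Y ** adj K ** X) $ i $ i) 1)"
    unfolding tr[symmetric] gram_root_def inner_diag_products adj_adj
    by (simp add: K_def adj_mult)
  also have "\<dots> \<le> (\<Sum>i\<in>UNIV. e i * 1)"
  proof (intro sum_mono mult_left_mono)
    fix i
    have "(Y ** W') ** adj (Y ** W') = Y ** (W' ** adj W') ** adj Y"
      by (simp add: adj_mult matrix_mul_assoc)
    also have "\<dots> = mat 1" using B Y by (simp add: svd_def unit_mat_def)
    finally have 1: "(Y ** W') ** adj (Y ** W') = mat 1" .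
    have "(adj X ** W) ** adj (adj X ** W) = adj X ** (W ** adj W) ** X"
      by (simp add: adj_mult matrix_mul_assoc)
    also have "\<dots> = mat 1" using A unit_mat_left[OF X] by (simp add: svd_def)
    finally have 2: "(adj X ** W) ** adj (adj X ** W) = mat 1" .
    \<comment> \<open>Writing the contraction as an overlap of two orthonormal systems bounds its
      diagonal by Cauchy-Schwarz.\<close>
    have "Y ** adj K ** X = (Y ** W') ** adj (adj X ** W)"
      by (simp add: K_def adj_mult matrix_mul_assoc)
    then show "inner ((Y ** adj K ** X) $ i $ i) 1 \<le> 1"
      using inner_orthonormal_rows_le[OF 1 2] by simp
    show "e i \<ge> 0" using N by (simp add: svd_def)
  qed
  also have "\<dots> = inner (P ** A) B"
  proof -
    have "Y ** (adj Y ** adj X) ** X = mat 1"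
      using Y unit_mat_left[OF X] by (simp add: unit_mat_def matrix_mul_assoc)
    then show ?thesis
      unfolding inner_svd[OF PA B] G K_def[symmetric] tr
      by (simp add: mat_def inner_1_1)
  qed
  finally have "(norm (P ** A - B))\<^sup>2 \<le> (norm (gram_root d W - gram_root d' W'))\<^sup>2"
    using A B unfolding power2_norm_diff norm_svd[OF PA] norm_svd[OF B]
    by (simp add: norm_gram_root svd_def)
  then show ?thesis using P power2_le_imp_le norm_ge_zero by blast
qed

section \<open>Linear maps that are injective on differences of low rank\<close>

text \<open>Invertibility of the Vandermonde matrix, by Lagrange interpolation: the power sums are
  combined with the coefficients of a polynomial that vanishes on \<open>I\<close> except at
  \<open>k\<close>.\<close>

lemma power_sums_eq_0:
  fixes v :: "nat \<Rightarrow> 'a::field_char_0"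
  assumes "finite I" and sums: "\<And>j. j < card I \<Longrightarrow> (\<Sum>i\<in>I. of_nat i ^ j * v i) = 0"
    and "k \<in> I"
  shows "v k = 0"
proof -
  define p :: "'a poly" where "p = (\<Prod>i\<in>I - {k}. [:- of_nat i, 1:])"
  have "degree p \<le> (\<Sum>i\<in>I - {k}. degree [:- of_nat i :: 'a, 1:])"
    unfolding p_def by (rule degree_prod_sum_le[unfolded o_def]) (use assms in simp)
  also have "\<dots> = card (I - {k})" by simp
  also have "\<dots> < card I" using assms by (intro psubset_card_mono) auto
  finally have deg: "degree p < card I" .
  have "(\<Sum>i\<in>I. poly p (of_nat i) * v i)
      = (\<Sum>i\<in>I. \<Sum>j\<le>degree p. coeff p j * (of_nat i ^ j * v i))"
    by (simp add: poly_altdef sum_distrib_right mult.assoc)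
  also have "\<dots> = (\<Sum>j\<le>degree p. coeff p j * (\<Sum>i\<in>I. of_nat i ^ j * v i))"
    by (subst sum.swap) (simp add: sum_distrib_left)
  also have "\<dots> = 0" using deg by (intro sum.neutral ballI) (simp add: sums)
  finally have "(\<Sum>i\<in>I. poly p (of_nat i) * v i) = 0" .
  moreover have "poly p (of_nat i) = 0" if "i \<in> I - {k}" for i
    unfolding p_def poly_prod by (rule prod_zero) (use that assms(1) in auto)
  ultimately have "poly p (of_nat k) * v k = 0"
    using sum.remove[OF assms(1,3), of "\<lambda>i. poly p (of_nat i) * v i"] by simp
  moreover have "poly p (of_nat k) \<noteq> 0" using assms(1) by (simp add: p_def poly_prod)
  ultimately show ?thesis by simp
qed

text \<open>Diagonals are cleared from the corner inwards. Once those beyond \<open>k\<close>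
  vanish, the rows with a nonzero entry on diagonal \<open>k\<close> are independent, so there are
  at most \<open>r\<close> of them and the power sums determine the entries.\<close>

lemma upper_triangle_eq_0:
  fixes x :: "nat \<Rightarrow> nat \<Rightarrow> 'a::field_char_0"
  assumes rank: "\<And>I. I \<subseteq> {..<m} \<Longrightarrow> r < card I \<Longrightarrow>
      \<exists>c. (\<exists>i\<in>I. c i \<noteq> 0) \<and> (\<forall>j<m. (\<Sum>i\<in>I. c i * x i j) = 0)"
    and sums: "\<And>k j. k < m \<Longrightarrow> j < min r (m - k) \<Longrightarrow> (\<Sum>i<m - k. of_nat i ^ j * x i (i + k)) = 0"
    and "i + k < m"
  shows "x i (i + k) = 0"
  using assms(3)
proof (induction "m - k" arbitrary: i k rule: less_induct)
  case less
  have IH: "x i (i + k') = 0" if "k < k'" "i + k' < m" for i k'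
    using that by (intro less.hyps) auto
  define V where "V = {i. i < m - k \<and> x i (i + k) \<noteq> 0}"
  have V: "finite V" "V \<subseteq> {..<m - k}" by (auto simp: V_def)
  have "card V \<le> r"
  proof (rule ccontr)
    assume "\<not> card V \<le> r"
    moreover have "V \<subseteq> {..<m}" using V(2) by auto
    ultimately obtain c where c: "\<exists>i\<in>V. c i \<noteq> 0" "\<And>j. j < m \<Longrightarrow> (\<Sum>i\<in>V. c i * x i j) = 0"
      using rank[of V] by (meson not_le)
    \<comment> \<open>In column \<open>i0 + k\<close> only row \<open>i0\<close> contributes:
      smaller rows meet it beyond diagonal \<open>k\<close>, and larger rows have coefficient
      0.\<close>
    define i0 where "i0 = Max {i \<in> V. c i \<noteq> 0}"
    have i0: "i0 \<in> {i \<in> V. c i \<noteq> 0}" unfolding i0_def using c(1) V(1) by (intro Max_in) auto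
    have "c i * x i (i0 + k) = 0" if "i \<in> V - {i0}" for i
    proof (cases "i < i0")
      case True
      have "x i (i + (i0 - i + k)) = 0" using True i0 V(2) by (intro IH) auto
      then show ?thesis using True by simp
    next
      case False
      have "i \<le> i0" if "c i \<noteq> 0"
        unfolding i0_def using that \<open>i \<in> V - {i0}\<close> V(1) by (intro Max_ge) auto
      then show ?thesis using False that by force
    qed
    then have "(\<Sum>i\<in>V - {i0}. c i * x i (i0 + k)) = 0" by (rule sum.neutral[OF ballI])
    then have "c i0 * x i0 (i0 + k) = (\<Sum>i\<in>V. c i * x i (i0 + k))"
      using i0 sum.remove[OF V(1), of i0 "\<lambda>i. c i * x i (i0 + k)"] by simp
    also have "\<dots> = 0" by (rule c(2)) (use i0 V(2) in auto)
    finally show False using i0 by (auto simp: V_def)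
  qed
  moreover have "card V \<le> m - k" using card_mono[OF _ V(2)] by simp
  \<comment> \<open>A short diagonal has only \<open>m - k\<close> entries, hence the minimum in the
    number of power sums.\<close>
  ultimately have card: "card V \<le> min r (m - k)" by simp
  have "(\<Sum>i\<in>V. of_nat i ^ j * x i (i + k)) = 0" if "j < card V" for j
  proof -
    have "(\<Sum>i\<in>V. of_nat i ^ j * x i (i + k)) = (\<Sum>i<m - k. of_nat i ^ j * x i (i + k))"
      by (rule sum.mono_neutral_left) (auto simp: V_def)
    also have "\<dots> = 0" by (rule sums) (use that card less.prems in auto)
    finally show ?thesis .
  qed
  then have "x i (i + k) = 0" if "i \<in> V" for i
    using power_sums_eq_0[OF V(1), of "\<lambda>i. x i (i + k)"] that by blast
  moreover have "i < m - k" using less.prems by simp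
  ultimately show ?case by (auto simp: V_def)
qed

section \<open>Linear maps bounded below on closed cones\<close>

lemma linear_coordinates:
  fixes \<phi> :: "'i \<Rightarrow> 'v::real_vector \<Rightarrow> real"
  assumes "finite T" "card T \<le> CARD('m::finite)" "\<And>t. t \<in> T \<Longrightarrow> linear (\<phi> t)"
  shows "\<exists>L :: 'v \<Rightarrow> real^'m. linear L \<and> (\<forall>X. L X = 0 \<longrightarrow> (\<forall>t\<in>T. \<phi> t X = 0))"
proof -
  obtain f :: "'i \<Rightarrow> 'm" where f: "inj_on f T"
    using card_le_inj[OF assms(1) finite[of UNIV] assms(2)] by auto
  define L :: "'v \<Rightarrow> real^'m" where
    \<comment> \<open>Coordinates beyond the number of functionals are padded with 0.\<close>
    "L X = (\<chi> \<mu>. if \<mu> \<in> f ` T then \<phi> (inv_into T f \<mu>) X else 0)" for X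
  have lin: "linear (\<phi> (inv_into T f \<mu>))" if "\<mu> \<in> f ` T" for \<mu>
    using assms(3) that by (simp add: inv_into_into)
  have "linear L"
    by (rule linearI) (auto simp: L_def vec_eq_iff linear_add[OF lin] linear_scale[OF lin])
  moreover have "\<phi> t X = 0" if "L X = 0" "t \<in> T" for t X
    using that f by (auto simp: L_def vec_eq_iff dest: spec[of _ "f t"])
  ultimately show ?thesis by blast
qed

text \<open>The minimum of \<open>norm (L X)\<close> over the compact set of unit vectors in
  \<open>K\<close> is positive, and scaling extends the bound to the cone.\<close>

lemma linear_bounded_below_on_cone:
  fixes L :: "'v::euclidean_space \<Rightarrow> 'w::real_normed_vector"
  assumes "closed K" "linear L" and cone: "\<And>X t. X \<in> K \<Longrightarrow> t > 0 \<Longrightarrow> t *\<^sub>R X \<in> K"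
    and ker: "\<And>X. X \<in> K \<Longrightarrow> L X = 0 \<Longrightarrow> X = 0"
  shows "\<exists>c>0. \<forall>X\<in>K. c * norm X \<le> norm (L X)"
proof (cases "K \<inter> sphere 0 1 = {}")
  \<comment> \<open>Here the cone contains at most 0, so the constant 1 serves.\<close>
  case True
  have zero: "X = 0" if "X \<in> K" for X
  proof (rule ccontr)
    assume "X \<noteq> 0"
    then have "(1 / norm X) *\<^sub>R X \<in> K \<inter> sphere 0 1" using cone[OF that, of "1 / norm X"] by simp
    with True show False by blast
  qed
  have "1 * norm X \<le> norm (L X)" if "X \<in> K" for X
    unfolding zero[OF that] by simp
  then show ?thesis by (intro exI[of _ "1::real"] conjI ballI) simp_all
next
  case False
  have "compact (K \<inter> sphere 0 1)" using assms(1) by (simp add: closed_Int_compact)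
  moreover have "continuous_on (K \<inter> sphere 0 1) (\<lambda>X. norm (L X))"
    using assms(2) by (intro continuous_intros linear_continuous_on)
      (simp add: linear_conv_bounded_linear)
  ultimately obtain Y where Y: "Y \<in> K \<inter> sphere 0 1"
    "\<And>X. X \<in> K \<inter> sphere 0 1 \<Longrightarrow> norm (L Y) \<le> norm (L X)"
    using continuous_attains_inf[OF _ False] by blast
  have "L Y \<noteq> 0" using Y(1) ker[of Y] by auto
  then have pos: "norm (L Y) > 0" by simp
  have le: "norm (L Y) * norm X \<le> norm (L X)" if X: "X \<in> K" for X
  proof (cases "X = 0")
    case False
    then have "(1 / norm X) *\<^sub>R X \<in> K \<inter> sphere 0 1" using cone[OF X, of "1 / norm X"] by simp
    from Y(2)[OF this] False show ?thesis
      by (simp add: linear_scale[OF assms(2)] field_simps)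
  qed (simp add: linear_0[OF assms(2)])
  show ?thesis using pos le by (intro exI[of _ "norm (L Y)"]) simp
qed

text \<open>
  Row rank at most \<open>r\<close>, phrased with unit vectors so that compactness of the sphere makes the set of
  these matrices closed.
\<close>

definition low_rank :: "nat \<Rightarrow> 'a::conj_field^'l^'l \<Rightarrow> bool" where
  "low_rank r X \<longleftrightarrow> (\<forall>I. r < card I \<longrightarrow>
     (\<exists>c. norm c = 1 \<and> (\<forall>i. i \<notin> I \<longrightarrow> c $ i = 0) \<and> (\<forall>j. (\<Sum>i\<in>UNIV. c $ i * X $ i $ j) = 0)))"

text \<open>Only columns are required to vanish; the symmetry carries this over to rows.\<close>

definition herm_on :: "'l set \<Rightarrow> 'a::conj_field^'l^'l \<Rightarrow> bool" where
  "herm_on J X \<longleftrightarrow> (\<forall>i j. conjugate (X $ i $ j) = X $ j $ i) \<and> (\<forall>i j. j \<notin> J \<longrightarrow> X $ i $ j = 0)"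

lemma herm_on_zero: "herm_on J X \<Longrightarrow> i \<notin> J \<or> j \<notin> J \<Longrightarrow> X $ i $ j = 0"
  unfolding herm_on_def by (metis conj_0 conj_conj)

lemma conj_scaleR: "conjugate (t *\<^sub>R x) = t *\<^sub>R conjugate (x::'a::conj_field)"
  by (simp add: scaleR_conv_of_real conj_mult)

lemma herm_on_scaleR: "herm_on J X \<Longrightarrow> herm_on J (t *\<^sub>R X)"
  by (simp add: herm_on_def conj_scaleR)

lemma closed_herm_on: "closed {X :: 'a::conj_field^'l^'l. herm_on J X}"
  unfolding herm_on_def
  by (intro closed_Collect_conj closed_Collect_all closed_Collect_imp closed_Collect_eq
      continuous_intros) auto

text \<open>The set is the projection of a closed set along a compact factor. One inequality
  \<open>f \<le> 0\<close> serves both for kernel conditions and for signs of quadratic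
  forms.\<close>

lemma closed_exists_unit_vector:
  assumes "continuous_on UNIV (\<lambda>z :: ('a::conj_field^'l) \<times> 'v::euclidean_space. f z :: real)"
  shows "closed {X. \<exists>c. (norm c = 1 \<and> (\<forall>i. i \<notin> I \<longrightarrow> c $ i = 0)) \<and> f (c, X) \<le> 0}"
proof -
  have "closed {c :: 'a^'l. norm c = 1 \<and> (\<forall>i. i \<notin> I \<longrightarrow> c $ i = 0)}"
    by (intro closed_Collect_conj closed_Collect_all closed_Collect_imp closed_Collect_eq
        continuous_intros) auto
  moreover have "bounded {c :: 'a^'l. norm c = 1 \<and> (\<forall>i. i \<notin> I \<longrightarrow> c $ i = 0)}"
    unfolding bounded_iff by (intro exI[of _ 1]) auto
  ultimately have "compact {c :: 'a^'l. norm c = 1 \<and> (\<forall>i. i \<notin> I \<longrightarrow> c $ i = 0)}"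
    by (simp add: compact_eq_bounded_closed)
  moreover have "closed {z. f z \<le> 0}"
    using assms by (intro closed_Collect_le continuous_intros)
  ultimately show ?thesis
    by (drule_tac closed_compact_projection) auto
qed

lemma closed_low_rank: "closed {X :: 'a::conj_field^'l^'l. low_rank r X}"
proof -
  \<comment> \<open>A sum of norms is nonpositive exactly when all terms vanish, so all kernel
    equations become one inequality.\<close>
  let ?f = "\<lambda>(c, X :: 'a^'l^'l). \<Sum>j\<in>UNIV. norm (\<Sum>i\<in>UNIV. c $ i * X $ i $ j)"
  have "(\<forall>j. (\<Sum>i\<in>UNIV. c $ i * X $ i $ j) = 0) \<longleftrightarrow> ?f (c, X) \<le> 0" for c and X :: "'a^'l^'l"
    by (simp add: sum_nonneg_eq_0_iff sum_nonneg antisym_conv)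
  moreover have "continuous_on UNIV ?f"
    unfolding case_prod_unfold by (intro continuous_intros)
  ultimately show ?thesis
    unfolding low_rank_def conj_assoc[symmetric]
    by (simp only:) (intro closed_Collect_all closed_Collect_imp closed_exists_unit_vector open_Collect_const)
qed

lemma low_rank_scaleR: "low_rank r X \<Longrightarrow> low_rank r (t *\<^sub>R X)"
  unfolding low_rank_def by (force simp flip: scaleR_right.sum)

lemma conj_power: "conjugate (x ^ k) = conjugate (x::'a::conj_field) ^ k"
  by (induction k) (simp_all add: conj_mult)

text \<open>Power sums along the main diagonal of a Hermitian matrix are real and cost one real
  coordinate; elsewhere all \<open>DIM('a)\<close> coordinates are needed.\<close>

lemma conj_invariant_eq_0_Basis:
  fixes x :: "'a::conj_field"
  assumes "\<And>b. b \<in> (if self then {1} else Basis) \<Longrightarrow> inner x b = 0" "self \<Longrightarrow> conjugate x = x"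
  shows "x = 0"
  using assms conj_invariant_eq_0[of x] euclidean_all_zero_iff[of x] by (cases self) auto

text \<open>The enumeration \<open>e\<close> of \<open>J\<close> carries
  \<open>upper_triangle_eq_0\<close> over to \<open>X\<close>; the lower triangle follows by
  symmetry.\<close>

lemma herm_low_rank_eq_0:
  fixes X :: "'a::conj_field^'l^'l"
  assumes e: "bij_betw e {..<m} J" and herm: "herm_on J X" and rank: "low_rank r X"
    and sums: "\<And>k j. k < m \<Longrightarrow> j < min r (m - k) \<Longrightarrow>
      (\<Sum>i<m - k. of_nat i ^ j * X $ e i $ e (i + k)) = 0"
  shows "X = 0"
proof -
  have upper: "X $ e i $ e (i + k) = 0" if "i + k < m" for i k
  proof (rule upper_triangle_eq_0[where x = "\<lambda>i j. X $ e i $ e j", OF _ sums that])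
    fix I :: "nat set"
    assume I: "I \<subseteq> {..<m}" "r < card I"
    have inj: "inj_on e I" using e I(1) by (meson bij_betw_def inj_on_subset)
    then have "r < card (e ` I)" using I(2) by (simp add: card_image)
    then obtain c where c: "norm c = 1" "\<And>i. i \<notin> e ` I \<Longrightarrow> c $ i = 0"
      "\<And>j. (\<Sum>i\<in>UNIV. c $ i * X $ i $ j) = 0"
      using rank unfolding low_rank_def by blast
    have "(\<Sum>i\<in>I. c $ e i * X $ e i $ j) = (\<Sum>i\<in>e ` I. c $ i * X $ i $ j)" for j
      by (simp add: sum.reindex[OF inj])
    also have "\<dots> j = (\<Sum>i\<in>UNIV. c $ i * X $ i $ j)" for j
      by (rule sum.mono_neutral_left) (auto simp: c(2))
    finally have "(\<Sum>i\<in>I. c $ e i * X $ e i $ j) = 0" for j by (simp add: c(3))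
    moreover have "\<exists>i\<in>I. c $ e i \<noteq> 0"
    proof (rule ccontr)
      assume "\<not> ?thesis"
      then have "c $ i = 0" for i using c(2)[of i] by auto
      then have "c = 0" by (simp add: vec_eq_iff)
      then show False using c(1) by simp
    qed
    ultimately show "\<exists>c. (\<exists>i\<in>I. c i \<noteq> 0) \<and> (\<forall>j<m. (\<Sum>i\<in>I. c i * X $ e i $ e j) = 0)"
      by (intro exI[of _ "\<lambda>i. c $ e i"]) blast
  qed
  have "X $ i $ j = 0" for i j
  proof (cases "i \<in> J \<and> j \<in> J")
    case True
    then obtain a b where ab: "a < m" "b < m" "i = e a" "j = e b"
      using e unfolding bij_betw_def by blast
    show ?thesis
    proof (cases "a \<le> b")
      case True
      then show ?thesis using upper[of a "b - a"] ab by simp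
    next
      case False
      then have "X $ j $ i = 0" using upper[of b "a - b"] ab by simp
      then show ?thesis using herm unfolding herm_on_def by (metis conj_0)
    qed
  qed (use herm herm_on_zero in blast)
  then show ?thesis by (simp add: vec_eq_iff)
qed

text \<open>The sum in the assumption counts the real functionals: \<open>min r (card J - k)\<close>
  power sums on diagonal \<open>k\<close>, each with one or \<open>DIM('a)\<close> real
  coordinates.\<close>

lemma linear_bounded_below_low_rank:
  fixes J :: "'l::finite set"
  assumes "(\<Sum>k<card J. min r (card J - k) * (if k = 0 then 1 else DIM('a))) \<le> CARD('m::finite)"
  shows "\<exists>(L :: 'a::conj_field^'l^'l \<Rightarrow> real^'m) c. linear L \<and> c > 0 \<and>
    (\<forall>X. herm_on J X \<and> low_rank r X \<longrightarrow> c * norm X \<le> norm (L X))"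
proof -
  define m where "m = card J"
  obtain e where e: "bij_betw e {..<m} J"
    using ex_bij_betw_nat_finite[of J] by (auto simp: m_def lessThan_atLeast0)
  define F where "F k j X = (\<Sum>i<m - k. of_nat i ^ j * X $ e i $ e (i + k))"
    for k j and X :: "'a^'l^'l"
  define B :: "nat \<Rightarrow> 'a set" where "B k = (if k = 0 then {1} else Basis)" for k
  define T where "T = (SIGMA k:{..<m}. {..<min r (m - k)} \<times> B k)"
  have "card T \<le> CARD('m)"
    using assms unfolding T_def m_def[symmetric]
    by (subst card_SigmaI) (auto simp: B_def card_cartesian_product if_distrib cong: if_cong)
  moreover have "linear (\<lambda>X. case t of (k, j, b) \<Rightarrow> inner (F k j X) b)" for t
    by (cases t) (auto intro!: linearI simp: F_def distrib_left sum.distrib inner_add_left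
        simp flip: scaleR_right.sum)
  moreover have "finite T" by (auto simp: T_def B_def)
  ultimately obtain L :: "'a^'l^'l \<Rightarrow> real^'m" where L: "linear L"
    "\<And>X t. L X = 0 \<Longrightarrow> t \<in> T \<Longrightarrow> (case t of (k, j, b) \<Rightarrow> inner (F k j X) b) = 0"
    using linear_coordinates[of T "\<lambda>t X. case t of (k, j, b) \<Rightarrow> inner (F k j X) b"] by metis
  let ?K = "{X :: 'a^'l^'l. herm_on J X \<and> low_rank r X}"
  have "\<exists>c>0. \<forall>X\<in>?K. c * norm X \<le> norm (L X)"
  proof (rule linear_bounded_below_on_cone[OF _ L(1)])
    show "closed ?K" by (intro closed_Collect_conj closed_herm_on closed_low_rank)
    show "t *\<^sub>R X \<in> ?K" if "X \<in> ?K" "t > 0" for X t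
      using that by (simp add: herm_on_scaleR low_rank_scaleR)
    fix X assume X: "X \<in> ?K" "L X = 0"
    have F: "F k j X = 0" if "k < m" "j < min r (m - k)" for k j
    proof (rule conj_invariant_eq_0_Basis[of "k = 0"])
      show "inner (F k j X) b = 0" if "b \<in> (if k = 0 then {1} else Basis)" for b
        using L(2)[OF X(2), of "(k, j, b)"] that \<open>k < m\<close> \<open>j < min r (m - k)\<close>
        by (simp add: T_def B_def)
      show "conjugate (F k j X) = F k j X" if "k = 0"
        using that X(1) by (simp add: F_def conj_sum conj_mult conj_power herm_on_def)
    qed
    show "X = 0" by (rule herm_low_rank_eq_0[OF e _ _ F[unfolded F_def]]) (use X(1) in auto)
  qed
  with L(1) show ?thesis by auto
qed

section \<open>Hermitian matrices whose quadratic form is not definite\<close>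

definition quad :: "'a::conj_field^'l \<Rightarrow> 'a^'l^'l \<Rightarrow> real" where
  "quad c X = inner (\<Sum>i\<in>UNIV. \<Sum>j\<in>UNIV. c $ i * X $ i $ j * conjugate (c $ j)) 1"

text \<open>The weak inequalities keep the condition closed. It still excludes nonzero real
  multiples of the identity on \<open>J\<close>.\<close>

definition indefinite_on :: "'l set \<Rightarrow> 'a::conj_field^'l^'l \<Rightarrow> bool" where
  "indefinite_on J X \<longleftrightarrow>
     (\<exists>c. (norm c = 1 \<and> (\<forall>i. i \<notin> J \<longrightarrow> c $ i = 0)) \<and> quad c X \<le> 0) \<and>
     (\<exists>c. (norm c = 1 \<and> (\<forall>i. i \<notin> J \<longrightarrow> c $ i = 0)) \<and> - quad c X \<le> 0)"

lemma closed_indefinite_on: "closed {X :: 'a::conj_field^'l^'l. indefinite_on J X}"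
proof -
  have "continuous_on UNIV (\<lambda>z :: ('a^'l) \<times> ('a^'l^'l). quad (fst z) (snd z))"
    unfolding quad_def by (intro continuous_intros)
  from closed_exists_unit_vector[OF this, of J]
    closed_exists_unit_vector[OF continuous_on_minus[OF this], of J]
  show ?thesis
    unfolding indefinite_on_def fst_conv snd_conv by (rule closed_Collect_conj)
qed

lemma quad_scaleR: "quad c (t *\<^sub>R X) = t * quad c X"
  by (simp add: quad_def inner_sum_left sum_distrib_left)

lemma indefinite_on_scaleR: "indefinite_on J X \<Longrightarrow> t > 0 \<Longrightarrow> indefinite_on J (t *\<^sub>R X)"
  unfolding indefinite_on_def quad_scaleR
  by (metis minus_mult_right mult_le_0_iff order_less_imp_le)

lemma quad_scalar_on:
  assumes "\<And>i j. X $ i $ j = (if i = j \<and> i \<in> J then x else 0)"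
    and "norm c = 1" "\<And>i. i \<notin> J \<Longrightarrow> c $ i = 0"
  shows "quad c X = inner x 1"
proof -
  have "(\<Sum>i\<in>UNIV. \<Sum>j\<in>UNIV. c $ i * X $ i $ j * conjugate (c $ j))
      = (\<Sum>i\<in>UNIV. \<Sum>j\<in>UNIV. if j = i then x * (c $ i * conjugate (c $ i)) else 0)"
    by (intro sum.cong refl) (auto simp: assms(1,3))
  also have "\<dots> = x * hip c c" by (simp add: hip_def sum_distrib_left)
  finally show ?thesis using assms(2) by (simp add: quad_def hip_self)
qed

text \<open>The map records the off-diagonal entries and the differences of diagonal entries. Its
  kernel on Hermitian matrices consists of the real multiples of the identity on \<open>J\<close>,
  whose quadratic form is constant on unit vectors.\<close>

lemma linear_bounded_below_indefinite:
  fixes J :: "'l::finite set"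
  assumes "(\<Sum>k<card J. if k = 0 then card J - 1 else (card J - k) * DIM('a)) \<le> CARD('m::finite)"
  shows "\<exists>(L :: 'a::conj_field^'l^'l \<Rightarrow> real^'m) c. linear L \<and> c > 0 \<and>
    (\<forall>X. herm_on J X \<and> indefinite_on J X \<longrightarrow> c * norm X \<le> norm (L X))"
proof -
  define m where "m = card J"
  obtain e where e: "bij_betw e {..<m} J"
    using ex_bij_betw_nat_finite[of J] by (auto simp: m_def lessThan_atLeast0)
  define F where "F k i X = X $ e i $ e (i + k) - (if k = 0 then X $ e 0 $ e 0 else 0)"
    for k i and X :: "'a^'l^'l"
  \<comment> \<open>On the main diagonal the index starts at 1, since the difference at 0 is
    trivially 0; this saves the one coordinate.\<close>
  define B :: "nat \<Rightarrow> (nat \<times> 'a) set" where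
    "B k = (if k = 0 then {1..<m} \<times> {1} else {..<m - k} \<times> Basis)" for k
  define T where "T = (SIGMA k:{..<m}. B k)"
  have "card T \<le> CARD('m)"
    using assms unfolding T_def m_def[symmetric]
    by (subst card_SigmaI) (auto simp: B_def card_cartesian_product if_distrib cong: if_cong)
  moreover have "linear (\<lambda>X. case t of (k, i, b) \<Rightarrow> inner (F k i X) b)" for t
    by (cases t) (auto intro!: linearI simp: F_def inner_add_left inner_diff_left algebra_simps)
  moreover have "finite T" by (auto simp: T_def B_def)
  ultimately obtain L :: "'a^'l^'l \<Rightarrow> real^'m" where L: "linear L"
    "\<And>X t. L X = 0 \<Longrightarrow> t \<in> T \<Longrightarrow> (case t of (k, i, b) \<Rightarrow> inner (F k i X) b) = 0"
    using linear_coordinates[of T "\<lambda>t X. case t of (k, i, b) \<Rightarrow> inner (F k i X) b"] by metis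
  let ?K = "{X :: 'a^'l^'l. herm_on J X \<and> indefinite_on J X}"
  have "\<exists>c>0. \<forall>X\<in>?K. c * norm X \<le> norm (L X)"
  proof (rule linear_bounded_below_on_cone[OF _ L(1)])
    show "closed ?K" by (intro closed_Collect_conj closed_herm_on closed_indefinite_on)
    show "t *\<^sub>R X \<in> ?K" if "X \<in> ?K" "t > 0" for X t
      using that by (simp add: herm_on_scaleR indefinite_on_scaleR)
    fix X assume X: "X \<in> ?K" "L X = 0"
    have conj: "conjugate (X $ i $ j) = X $ j $ i" for i j using X(1) by (simp add: herm_on_def)
    have F: "F k i X = 0" if "i + k < m" for k i
    proof (cases "k = 0 \<and> i = 0")
      case False
      show ?thesis
      proof (rule conj_invariant_eq_0_Basis[of "k = 0"])
        show "inner (F k i X) b = 0" if "b \<in> (if k = 0 then {1} else Basis)" for b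
          using L(2)[OF X(2), of "(k, i, b)"] that \<open>i + k < m\<close> False
          by (auto simp: T_def B_def split: if_splits)
        show "conjugate (F k i X) = F k i X" if "k = 0"
          using that by (simp add: F_def conj_diff conj)
      qed
    qed (simp add: F_def)
    define x where "x = X $ e 0 $ e 0"
    have eq: "X $ i $ j = (if i = j \<and> i \<in> J then x else 0)" for i j
    proof (cases "i \<in> J \<and> j \<in> J")
      case True
      then obtain a b where ab: "a < m" "b < m" "i = e a" "j = e b"
        using e unfolding bij_betw_def by blast
      have ij: "i = j \<longleftrightarrow> a = b" using ab e by (auto simp: bij_betw_def inj_on_def)
      consider "a < b" | "a = b" | "b < a" by linarith
      then show ?thesis
      proof cases
        case 1
        then show ?thesis using F[of a "b - a"] ab ij by (simp add: F_def)
      next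
        case 2
        then show ?thesis using F[of a 0] ab True by (simp add: F_def x_def)
      next
        case 3
        then have "X $ j $ i = 0" using F[of b "a - b"] ab by (simp add: F_def)
        then have "X $ i $ j = 0" using conj[of j i] by simp
        then show ?thesis using 3 ij by simp
      qed
    next
      case False
      then show ?thesis using X(1) herm_on_zero[of J X i j] by auto
    qed
    have "inner x 1 \<le> 0" "inner x 1 \<ge> 0"
      using X(1) quad_scalar_on[OF eq] unfolding indefinite_on_def by auto
    moreover have "conjugate x = x" by (simp add: x_def conj)
    ultimately have "x = 0" using conj_invariant_eq_0[of x] by simp
    then show "X = 0" by (simp add: vec_eq_iff eq)
  qed
  with L(1) show ?thesis by auto
qed

section \<open>Bi-Lipschitz maps\<close>

lemma gram_root_nth:
  "gram_root d W $ i $ j = (\<Sum>t\<in>UNIV. conjugate (W $ t $ i) * (of_real (d t) * W $ t $ j))"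
proof -
  have "gram_root d W = adj W ** (diag d ** W)" by (simp add: gram_root_def matrix_mul_assoc)
  then show ?thesis
    by (simp add: matrix_matrix_mult_def[of "adj W" "diag d ** W"] diag_mult) (simp add: adj_def)
qed

lemma conj_gram_root: "conjugate (gram_root d W $ i $ j) = gram_root d W $ j $ i"
  by (simp add: gram_root_nth conj_sum conj_mult mult_ac)

text \<open>A zero column of \<open>A\<close> is also one of
  \<open>adj Q ** A = diag d ** W\<close>, the right part of the root.\<close>

lemma gram_root_zero_column:
  assumes "svd A Q d W" "\<And>i. A $ i $ j = 0"
  shows "gram_root d W $ i $ j = 0"
proof -
  have "diag d ** W = adj Q ** A"
    using assms(1) unit_mat_left[of Q] by (simp add: svd_def matrix_mul_assoc)
  then have "of_real (d t) * W $ t $ j = 0" for t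
    unfolding diag_mult[symmetric] by (simp add: matrix_matrix_mult_def assms(2))
  then show ?thesis by (simp only: gram_root_nth mult_zero_right sum.neutral_const)
qed

lemma gram_root_kernel:
  assumes "\<And>t. (\<Sum>i\<in>UNIV. c $ i * conjugate (W $ t $ i)) = 0"
  shows "(\<Sum>i\<in>UNIV. c $ i * gram_root d W $ i $ j) = 0"
proof -
  have "(\<Sum>i\<in>UNIV. c $ i * gram_root d W $ i $ j)
      = (\<Sum>t\<in>UNIV. (\<Sum>i\<in>UNIV. c $ i * conjugate (W $ t $ i)) * (of_real (d t) * W $ t $ j))"
    unfolding gram_root_nth sum_distrib_left sum_distrib_right
    by (subst sum.swap) (simp add: mult.assoc)
  then show ?thesis by (simp add: assms)
qed

lemma quad_diff: "quad c (X - Y) = quad c X - quad c Y"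
  by (simp add: quad_def algebra_simps sum_subtractf inner_diff_left)

text \<open>The form is diagonal in the coordinates \<open>y t\<close> of \<open>c\<close> along the
  rows of \<open>W\<close>, with weights \<open>d t\<close>.\<close>

lemma quad_gram_root_nonneg:
  assumes "\<And>t. d t \<ge> 0"
  shows "quad c (gram_root d W) \<ge> 0"
proof -
  define y where "y t = (\<Sum>i\<in>UNIV. c $ i * conjugate (W $ t $ i))" for t
  have col: "(\<Sum>i\<in>UNIV. c $ i * gram_root d W $ i $ j)
      = (\<Sum>t\<in>UNIV. y t * (of_real (d t) * W $ t $ j))"
    for j
    unfolding gram_root_nth sum_distrib_left sum_distrib_right y_def
    by (subst sum.swap) (simp add: mult.assoc)
  have "(\<Sum>i\<in>UNIV. \<Sum>j\<in>UNIV. c $ i * gram_root d W $ i $ j * conjugate (c $ j))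
      = (\<Sum>j\<in>UNIV. (\<Sum>i\<in>UNIV. c $ i * gram_root d W $ i $ j) * conjugate (c $ j))"
    unfolding sum_distrib_right by (rule sum.swap)
  also have "\<dots> = (\<Sum>t\<in>UNIV. \<Sum>j\<in>UNIV. y t * (of_real (d t) * W $ t $ j) * conjugate (c $ j))"
    unfolding col sum_distrib_right by (rule sum.swap)
  also have "\<dots> = (\<Sum>t\<in>UNIV. of_real (d t) * (y t * conjugate (y t)))"
  proof (intro sum.cong refl)
    fix t
    have "conjugate (y t) = (\<Sum>j\<in>UNIV. W $ t $ j * conjugate (c $ j))"
      by (simp add: y_def conj_sum conj_mult mult.commute)
    then show "(\<Sum>j\<in>UNIV. y t * (of_real (d t) * W $ t $ j) * conjugate (c $ j))
        = of_real (d t) * (y t * conjugate (y t))"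
      by (simp add: sum_distrib_left mult_ac)
  qed
  finally have "quad c (gram_root d W) = (\<Sum>t\<in>UNIV. d t * inner (y t * conjugate (y t)) 1)"
    by (simp add: quad_def inner_sum_left inner_of_real_1)
  also have "\<dots> \<ge> 0" by (intro sum_nonneg mult_nonneg_nonneg assms) (simp flip: inner_conj)
  finally show ?thesis .
qed

lemma quad_eq_0:
  assumes "\<And>j. (\<Sum>i\<in>UNIV. c $ i * X $ i $ j) = 0"
  shows "quad c X = 0"
proof -
  have "(\<Sum>i\<in>UNIV. \<Sum>j\<in>UNIV. c $ i * X $ i $ j * conjugate (c $ j))
      = (\<Sum>j\<in>UNIV. (\<Sum>i\<in>UNIV. c $ i * X $ i $ j) * conjugate (c $ j))"
    unfolding sum_distrib_right by (rule sum.swap)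
  then show ?thesis by (simp add: quad_def assms)
qed

text \<open>
  There is no type with \<open>CARD('l) - 1\<close> elements; matrices with that many columns are represented as
  matrices whose columns outside \<open>J\<close> vanish.
\<close>

definition supported_on :: "'l set \<Rightarrow> 'a::zero^'l^'n \<Rightarrow> bool" where
  "supported_on J A \<longleftrightarrow> (\<forall>i j. j \<notin> J \<longrightarrow> A $ i $ j = 0)"

lemma herm_on_gram_root_diff:
  assumes "svd A Q d W" "svd B Q' d' W'"
    and "supported_on J A" "supported_on J B"
  shows "herm_on J (gram_root d W - gram_root d' W')"
  using gram_root_zero_column[OF assms(1)] gram_root_zero_column[OF assms(2)] assms(3,4)
  by (auto simp: herm_on_def supported_on_def conj_diff conj_gram_root)

lemma low_rank_gram_root_diff:
  fixes W W' :: "'a::conj_field^'l^'n"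
  shows "low_rank (2 * CARD('n)) (gram_root d W - gram_root d' W')"
  unfolding low_rank_def
proof (intro allI impI)
  fix I :: "'l set"
  assume "2 * CARD('n) < card I"
  \<comment> \<open>The sum type indexes the rows of \<open>W\<close> and \<open>W'\<close> jointly;
    a vector orthogonal to all of them is annihilated by both roots.\<close>
  then have "card (UNIV <+> UNIV :: ('n + 'n) set) < card I" by (simp add: card_Plus)
  from unit_vector_in_kernel[OF _ this,
      of "\<lambda>i t. case t of Inl s \<Rightarrow> conjugate (W $ s $ i) | Inr s \<Rightarrow> conjugate (W' $ s $ i)"]
  obtain c :: "'a^'l" where c: "norm c = 1" "\<forall>i. i \<notin> I \<longrightarrow> c $ i = 0"
    and t: "\<And>t. t \<in> UNIV <+> UNIV \<Longrightarrow> (\<Sum>i\<in>UNIV. c $ i *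
      (case t of Inl s \<Rightarrow> conjugate (W $ s $ i) | Inr s \<Rightarrow> conjugate (W' $ s $ i))) = 0"
    by auto
  have "(\<Sum>i\<in>UNIV. c $ i * conjugate (W $ s $ i)) = 0"
    "(\<Sum>i\<in>UNIV. c $ i * conjugate (W' $ s $ i)) = 0" for s
    using t[of "Inl s"] t[of "Inr s"] by auto
  then have "\<forall>j. (\<Sum>i\<in>UNIV. c $ i * (gram_root d W - gram_root d' W') $ i $ j) = 0"
    by (simp add: right_diff_distrib sum_subtractf gram_root_kernel)
  with c show "\<exists>c. norm c = 1 \<and> (\<forall>i. i \<notin> I \<longrightarrow> c $ i = 0) \<and>
      (\<forall>j. (\<Sum>i\<in>UNIV. c $ i * (gram_root d W - gram_root d' W') $ i $ j) = 0)" by blast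
qed

text \<open>Each root has a kernel vector supported on \<open>J\<close>, because
  \<open>CARD('n) < card J\<close>. At a kernel vector of one root only the other, semidefinite one
  contributes to the difference, which fixes the sign.\<close>

lemma indefinite_on_gram_root_diff:
  fixes W W' :: "'a::conj_field^'l^'n"
  assumes "CARD('n) < card J" "\<And>t. d t \<ge> 0" "\<And>t. d' t \<ge> 0"
  shows "indefinite_on J (gram_root d W - gram_root d' W')"
proof -
  have "\<exists>c. (norm c = 1 \<and> (\<forall>i. i \<notin> J \<longrightarrow> c $ i = 0)) \<and> quad c (gram_root e V) = 0"
    for V :: "'a^'l^'n" and e
  proof -
    obtain c :: "'a^'l" where c: "norm c = 1" "\<forall>i. i \<notin> J \<longrightarrow> c $ i = 0"
      "\<And>t. (\<Sum>i\<in>UNIV. c $ i * conjugate (V $ t $ i)) = 0"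
      using unit_vector_in_kernel[OF finite[of UNIV] assms(1), of "\<lambda>i t. conjugate (V $ t $ i)"] by auto
    then show ?thesis using quad_eq_0[OF gram_root_kernel[OF c(3)]] by blast
  qed
  then obtain c c' where
    c: "norm c = 1 \<and> (\<forall>i. i \<notin> J \<longrightarrow> c $ i = 0)" "quad c (gram_root d W) = 0" and
    c': "norm c' = 1 \<and> (\<forall>i. i \<notin> J \<longrightarrow> c' $ i = 0)" "quad c' (gram_root d' W') = 0"
    by metis
  have "quad c (gram_root d W - gram_root d' W') \<le> 0"
    unfolding quad_diff c(2) using quad_gram_root_nonneg[OF assms(3)] by simp
  moreover have "- quad c' (gram_root d W - gram_root d' W') \<le> 0"
    unfolding quad_diff c'(2) using quad_gram_root_nonneg[OF assms(2)] by simp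
  ultimately show ?thesis
    unfolding indefinite_on_def using c(1) c'(1) by blast
qed

section \<open>Orbit distances and the root as a function of the matrix\<close>

lemma orbit_dist_le:
  assumes "g \<in> G"
  shows "orbit_dist G act A B \<le> norm (act g A - B)"
  unfolding orbit_dist_def using assms by (intro cINF_lower bdd_belowI2[of _ 0]) auto

lemma le_orbit_dist:
  assumes "G \<noteq> {}" "\<And>g. g \<in> G \<Longrightarrow> K \<le> norm (act g A - B)"
  shows "K \<le> orbit_dist G act A B"
  unfolding orbit_dist_def using assms by (intro cINF_greatest)

lemma unit_mat_one: "unit_mat (mat 1)"
proof -
  have "adj (mat 1) = mat 1" by (auto simp: adj_def mat_def vec_eq_iff)
  then show ?thesis by (simp add: unit_mat_def)
qed

text \<open>The choice is harmless: by \<open>norm_gram_root_diff_le\<close> with equal matrices,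
  all decompositions of \<open>A\<close> give the same root.\<close>

definition svd_root :: "'a::conj_field^'l^'n \<Rightarrow> 'a^'l^'l" where
  "svd_root A = (SOME S. \<exists>Q d W. svd A Q d W \<and> S = gram_root d W)"

lemma svd_rootE:
  fixes A :: "'a::conj_field^'l^'n"
  assumes "CARD('n) \<le> CARD('l)"
  obtains Q d W where "svd A Q d W" "svd_root A = gram_root d W"
  unfolding svd_root_def
  using someI_ex[of "\<lambda>S. \<exists>Q d W. svd A Q d W \<and> S = gram_root d W"] svd_exists[OF assms, of A]
  by blast

lemma svd_unit_mat_mult: "svd A Q d W \<Longrightarrow> unit_mat P \<Longrightarrow> svd (P ** A) (P ** Q) d W"
  by (auto simp: svd_def matrix_mul_assoc unit_mat_mult)

lemma orbit_dist_le_svd_root: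
  fixes A B :: "'a::conj_field^'l^'n"
  assumes "CARD('n) \<le> CARD('l)"
  shows "orbit_dist {P. unit_mat P} (**) A B \<le> norm (svd_root A - svd_root B)"
proof -
  obtain Q d W where A: "svd A Q d W" "svd_root A = gram_root d W" by (rule svd_rootE[OF assms])
  obtain Q' d' W' where B: "svd B Q' d' W'" "svd_root B = gram_root d' W'" by (rule svd_rootE[OF assms])
  from norm_orbit_le_gram_root_diff[OF A(1) B(1)] obtain P
    where "unit_mat P" "norm (P ** A - B) \<le> norm (svd_root A - svd_root B)"
    unfolding A(2) B(2) by blast
  then show ?thesis using orbit_dist_le[of P "{P. unit_mat P}" "(**)" A B] by simp
qed

text \<open>Moving \<open>A\<close> by a unitary matrix changes only the left factor of its
  decomposition, so the Lipschitz estimate holds with the same root at every point of the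
  orbit.\<close>

lemma svd_root_le_orbit_dist:
  fixes A B :: "'a::conj_field^'l^'n"
  assumes "CARD('n) \<le> CARD('l)"
  shows "norm (svd_root A - svd_root B) \<le> sqrt 2 * orbit_dist {P. unit_mat P} (**) A B"
proof -
  have "norm (svd_root A - svd_root B) / sqrt 2 \<le> orbit_dist {P. unit_mat P} (**) A B"
  proof (rule le_orbit_dist)
    show "{P :: 'a^'n^'n. unit_mat P} \<noteq> {}" using unit_mat_one by blast
    fix P assume "P \<in> {P :: 'a^'n^'n. unit_mat P}"
    then have P: "unit_mat P" by simp
    obtain Q d W where A: "svd A Q d W" "svd_root A = gram_root d W" by (rule svd_rootE[OF assms])
    obtain Q' d' W' where B: "svd B Q' d' W'" "svd_root B = gram_root d' W'" by (rule svd_rootE[OF assms])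
    show "norm (svd_root A - svd_root B) / sqrt 2 \<le> norm (P ** A - B)"
      using norm_gram_root_diff_le[OF svd_unit_mat_mult[OF A(1) P] B(1)]
      unfolding A(2) B(2) by (simp add: field_simps)
  qed
  then show ?thesis by (simp add: field_simps)
qed

text \<open>The first alternative uses the rank of the difference, the second its
  indefiniteness.\<close>

lemma linear_bounded_below_svd_root:
  fixes J :: "'l::finite set"
  assumes "CARD('n::finite) \<le> CARD('l)"
    and "(\<Sum>k<card J. min (2 * CARD('n)) (card J - k) * (if k = 0 then 1 else DIM('a))) \<le> CARD('m::finite) \<or>
      CARD('n) < card J \<and> (\<Sum>k<card J. if k = 0 then card J - 1 else (card J - k) * DIM('a)) \<le> CARD('m)"
  shows "\<exists>(L :: 'a::conj_field^'l^'l \<Rightarrow> real^'m) c. linear L \<and> c > 0 \<and>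
    (\<forall>(A :: 'a^'l^'n) (B :: 'a^'l^'n). supported_on J A \<longrightarrow> supported_on J B \<longrightarrow>
      c * norm (svd_root A - svd_root B) \<le> norm (L (svd_root A - svd_root B)))"
  using assms(2)
proof
  assume "(\<Sum>k<card J. min (2 * CARD('n)) (card J - k) * (if k = 0 then 1 else DIM('a))) \<le> CARD('m)"
  from linear_bounded_below_low_rank[OF this] obtain L :: "'a^'l^'l \<Rightarrow> real^'m" and c
    where L: "linear L" "c > 0" "\<forall>X. herm_on J X \<and> low_rank (2 * CARD('n)) X \<longrightarrow> c * norm X \<le> norm (L X)"
    by (elim exE conjE)
  have "c * norm (svd_root A - svd_root B) \<le> norm (L (svd_root A - svd_root B))"
    if AB: "supported_on J A" "supported_on J B" for A B :: "'a^'l^'n"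
  proof -
    obtain Q d W where A: "svd A Q d W" "svd_root A = gram_root d W" by (rule svd_rootE[OF assms(1)])
    obtain Q' d' W' where B: "svd B Q' d' W'" "svd_root B = gram_root d' W'" by (rule svd_rootE[OF assms(1)])
    show ?thesis
      unfolding A(2) B(2)
      by (intro L(3)[rule_format] conjI herm_on_gram_root_diff[OF A(1) B(1) AB] low_rank_gram_root_diff)
  qed
  then show ?thesis by (intro exI[of _ L] exI[of _ c] conjI allI impI L(1,2))
next
  assume asm: "CARD('n) < card J \<and>
    (\<Sum>k<card J. if k = 0 then card J - 1 else (card J - k) * DIM('a)) \<le> CARD('m)"
  from linear_bounded_below_indefinite[OF conjunct2[OF asm]] obtain L :: "'a^'l^'l \<Rightarrow> real^'m" and c
    where L: "linear L" "c > 0" "\<forall>X. herm_on J X \<and> indefinite_on J X \<longrightarrow> c * norm X \<le> norm (L X)"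
    by (elim exE conjE)
  have "c * norm (svd_root A - svd_root B) \<le> norm (L (svd_root A - svd_root B))"
    if AB: "supported_on J A" "supported_on J B" for A B :: "'a^'l^'n"
  proof -
    obtain Q d W where A: "svd A Q d W" "svd_root A = gram_root d W" by (rule svd_rootE[OF assms(1)])
    obtain Q' d' W' where B: "svd B Q' d' W'" "svd_root B = gram_root d' W'" by (rule svd_rootE[OF assms(1)])
    have "indefinite_on J (gram_root d W - gram_root d' W')"
      using A(1) B(1) asm by (intro indefinite_on_gram_root_diff) (auto simp: svd_def)
    then show ?thesis
      unfolding A(2) B(2)
      by (intro L(3)[rule_format] conjI herm_on_gram_root_diff[OF A(1) B(1) AB])
  qed
  then show ?thesis by (intro exI[of _ L] exI[of _ c] conjI allI impI L(1,2))
qed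

lemma bi_lipschitz_supported:
  fixes J :: "'l::finite set"
  assumes "CARD('n::finite) \<le> CARD('l)"
    and "(\<Sum>k<card J. min (2 * CARD('n)) (card J - k) * (if k = 0 then 1 else DIM('a))) \<le> CARD('m::finite) \<or>
      CARD('n) < card J \<and> (\<Sum>k<card J. if k = 0 then card J - 1 else (card J - k) * DIM('a)) \<le> CARD('m)"
  shows "\<exists>(f :: 'a::conj_field^'l^'n \<Rightarrow> real^'m) C1 C2. C1 > 0 \<and> C2 > 0 \<and>
    (\<forall>A B. supported_on J A \<longrightarrow> supported_on J B \<longrightarrow>
      C1 * orbit_dist {P. unit_mat P} (**) A B \<le> dist (f A) (f B) \<and>
      dist (f A) (f B) \<le> C2 * orbit_dist {P. unit_mat P} (**) A B)"
proof -
  from linear_bounded_below_svd_root[OF assms]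
  obtain L :: "'a^'l^'l \<Rightarrow> real^'m" and c where L: "linear L" "c > 0"
    "\<forall>(A :: 'a^'l^'n) (B :: 'a^'l^'n). supported_on J A \<longrightarrow> supported_on J B \<longrightarrow>
      c * norm (svd_root A - svd_root B) \<le> norm (L (svd_root A - svd_root B))"
    by (elim exE conjE)
  obtain K where K: "K > 0" "\<And>X. norm (L X) \<le> K * norm X"
    using linear_bounded_pos[OF L(1)] by blast
  define f where "f A = L (svd_root A)" for A :: "'a^'l^'n"
  have dist: "dist (f A) (f B) = norm (L (svd_root A - svd_root B))" for A B
    by (simp add: f_def dist_norm linear_diff[OF L(1)])
  have "c * orbit_dist {P. unit_mat P} (**) A B \<le> dist (f A) (f B)"
    if "supported_on J A" "supported_on J B" for A B
  proof -
    have "c * orbit_dist {P. unit_mat P} (**) A B \<le> c * norm (svd_root A - svd_root B)"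
      using L(2) by (intro mult_left_mono orbit_dist_le_svd_root assms(1)) simp
    also have "\<dots> \<le> dist (f A) (f B)" unfolding dist by (intro L(3)[rule_format] that)
    finally show ?thesis .
  qed
  moreover have "dist (f A) (f B) \<le> (K * sqrt 2) * orbit_dist {P. unit_mat P} (**) A B" for A B
  proof -
    have "dist (f A) (f B) \<le> K * norm (svd_root A - svd_root B)" unfolding dist by (rule K(2))
    also have "\<dots> \<le> K * (sqrt 2 * orbit_dist {P. unit_mat P} (**) A B)"
      using K(1) by (intro mult_left_mono svd_root_le_orbit_dist assms(1)) simp
    finally show ?thesis by (simp add: mult.assoc)
  qed
  moreover have "K * sqrt 2 > 0" using K(1) by simp
  ultimately show ?thesis
    by (intro exI[of _ f] exI[of _ c] exI[of _ "K * sqrt 2"] conjI allI impI L(2))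
qed

lemma bi_lipschitz_linear:
  assumes "CARD('n::finite) \<le> CARD('l::finite)"
    and "(\<Sum>k<CARD('l). min (2 * CARD('n)) (CARD('l) - k) * (if k = 0 then 1 else DIM('a))) \<le> CARD('m::finite)"
  shows "\<exists>f :: 'a::conj_field^'l^'n \<Rightarrow> real^'m. bi_lipschitz_wrt {P. unit_mat P} (**) f"
  using bi_lipschitz_supported[of "UNIV :: 'l set", where 'n='n and 'a='a and 'm='m] assms
  unfolding bi_lipschitz_wrt_def supported_on_def by simp

text \<open>The map \<open>R\<close> subtracts column \<open>j0\<close> from every column. This
  removes translations, commutes with left multiplication and makes column \<open>j0\<close> vanish,
  so the linear case on \<open>J\<close> applies.\<close>

lemma bi_lipschitz_affine:
  fixes J :: "'l::finite set"
  assumes "CARD('n::finite) \<le> CARD('l)" and J: "J = UNIV - {j0}"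
    and "(\<Sum>k<card J. min (2 * CARD('n)) (card J - k) * (if k = 0 then 1 else DIM('a))) \<le> CARD('m::finite) \<or>
      CARD('n) < card J \<and> (\<Sum>k<card J. if k = 0 then card J - 1 else (card J - k) * DIM('a)) \<le> CARD('m)"
  shows "\<exists>f :: 'a::conj_field^'l^'n \<Rightarrow> real^'m.
    bi_lipschitz_wrt {(P, q). unit_mat P} affine_act_columns f"
proof -
  let ?G = "{P :: 'a^'n^'n. unit_mat P}" and ?E = "{(P, q). unit_mat P} :: (('a^'n^'n) \<times> ('a^'n)) set"
  define R :: "'a^'l^'n \<Rightarrow> 'a^'l^'n" where "R A = (\<chi> i j. A $ i $ j - A $ i $ j0)" for A
  have R: "R A $ i $ j = A $ i $ j - A $ i $ j0" for A i j by (simp add: R_def)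
  have linR: "linear R" by (rule linearI) (auto simp: R vec_eq_iff algebra_simps)
  obtain K where K: "K > 0" "\<And>X. norm (R X) \<le> K * norm X"
    using linear_bounded_pos[OF linR] by blast
  have act: "affine_act_columns (P, q) A $ i $ j = (P ** A) $ i $ j + q $ i" for P q A i j
    by (simp add: affine_act_columns_def affine_act_def matrix_vector_mult_def
        matrix_matrix_mult_def column_def)
  have mult: "(P ** R A) $ i $ j = (P ** A) $ i $ j - (P ** A) $ i $ j0" for P A i j
    by (simp add: R matrix_matrix_mult_def right_diff_distrib sum_subtractf)
  have le: "orbit_dist ?E affine_act_columns A B \<le> orbit_dist ?G (**) (R A) (R B)" for A B
  proof (rule le_orbit_dist)
    show "?G \<noteq> {}" using unit_mat_one by blast
    fix P assume P: "P \<in> ?G"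
    \<comment> \<open>The translation that makes column \<open>j0\<close> of the moved matrix agree
      with that of \<open>B\<close>.\<close>
    define q where "q = (\<chi> i. B $ i $ j0 - (P ** A) $ i $ j0)"
    have "affine_act_columns (P, q) A - B = P ** R A - R B"
      by (simp add: vec_eq_iff act mult q_def R)
    then show "orbit_dist ?E affine_act_columns A B \<le> norm (P ** R A - R B)"
      using orbit_dist_le[of "(P, q)" ?E affine_act_columns A B] P by simp
  qed
  have ge: "orbit_dist ?G (**) (R A) (R B) / K \<le> orbit_dist ?E affine_act_columns A B" for A B
  proof (rule le_orbit_dist)
    show "?E \<noteq> {}" using unit_mat_one by blast
    fix g assume "g \<in> ?E"
    then obtain P q where g: "g = (P, q)" "unit_mat P" by auto
    have "R (affine_act_columns g A - B) = P ** R A - R B"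
      by (simp add: vec_eq_iff act mult R g)
    then have "orbit_dist ?G (**) (R A) (R B) \<le> K * norm (affine_act_columns g A - B)"
      using orbit_dist_le[of P ?G "(**)" "R A" "R B"] g(2) K(2) order_trans by (metis mem_Collect_eq)
    then show "orbit_dist ?G (**) (R A) (R B) / K \<le> norm (affine_act_columns g A - B)"
      using K(1) by (simp add: field_simps)
  qed
  obtain f :: "'a^'l^'n \<Rightarrow> real^'m" and C1 C2 where C: "C1 > 0" "C2 > 0"
    and f0: "\<forall>A B. supported_on J A \<longrightarrow> supported_on J B \<longrightarrow>
      C1 * orbit_dist ?G (**) A B \<le> dist (f A) (f B) \<and> dist (f A) (f B) \<le> C2 * orbit_dist ?G (**) A B"
    using bi_lipschitz_supported[OF assms(1,3)] by (elim exE conjE)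
  note f = f0[rule_format]
  have "C1 * orbit_dist ?E affine_act_columns A B \<le> dist (f (R A)) (f (R B))"
    "dist (f (R A)) (f (R B)) \<le> (C2 * K) * orbit_dist ?E affine_act_columns A B" for A B
  proof -
    have *: "supported_on J (R A)" for A by (simp add: J R supported_on_def)
    show "C1 * orbit_dist ?E affine_act_columns A B \<le> dist (f (R A)) (f (R B))"
      using order_trans[OF mult_left_mono[OF le]] f[OF * *] C(1) by simp
    have "orbit_dist ?G (**) (R A) (R B) \<le> K * orbit_dist ?E affine_act_columns A B"
      using ge[of A B] K(1) by (simp add: field_simps)
    then have "C2 * orbit_dist ?G (**) (R A) (R B) \<le> C2 * (K * orbit_dist ?E affine_act_columns A B)"
      using C(2) by (intro mult_left_mono) auto
    then show "dist (f (R A)) (f (R B)) \<le> (C2 * K) * orbit_dist ?E affine_act_columns A B"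
      using f[OF *[of A] *[of B]] by (simp add: mult.assoc)
  qed
  moreover have "C2 * K > 0" using C(2) K(1) by simp
  ultimately show ?thesis
    unfolding bi_lipschitz_wrt_def using C(1)
    by (intro exI[of _ "\<lambda>A. f (R A)"] exI[of _ C1] exI[of _ "C2 * K"] conjI allI) assumption+
qed

section \<open>Counting the coordinates\<close>

text \<open>Splits off the main diagonal, which has weight 1; the remaining diagonals are those of a
  matrix of size \<open>m\<close>.\<close>

lemma sum_min_Suc:
  "(\<Sum>k<Suc m. min r (Suc m - k) * (if k = 0 then 1 else D))
    = min r (Suc m) + D * (\<Sum>k<m. min r (m - k))" for r m D :: nat
  unfolding sum.lessThan_Suc_shift by (simp add: sum_distrib_left mult.commute)

lemma sum_min_small: "m \<le> r \<Longrightarrow> 2 * (\<Sum>k<m. min r (m - k)) = m * (m + 1)" for m r :: nat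
proof (induction m)
  case (Suc m)
  then show ?case using sum_min_Suc[of r m 1] by (simp add: algebra_simps)
qed simp

text \<open>The boundary case \<open>r = m + 1\<close> occurs for the real affine group when
  \<open>CARD('l) = 2 * CARD('n)\<close>. The term \<open>r * r\<close> stands on the left to avoid
  truncated subtraction.\<close>

lemma sum_min:
  fixes m r :: nat
  assumes "r \<le> m + 1"
  shows "2 * (\<Sum>k<m. min r (m - k)) + r * r = r * (2 * m + 1)"
proof (cases "r = m + 1")
  case True
  then show ?thesis using sum_min_small[of m r] by (simp add: algebra_simps)
next
  case False
  then have "r \<le> m" using assms by simp
  then show ?thesis
  proof (induction m rule: dec_induct)
    case base
    then show ?case using sum_min_small[of r r] by (simp add: algebra_simps)
  next
    case (step m)
    then show ?case using sum_min_Suc[of r m 1] by (simp add: algebra_simps)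
  qed
qed

section \<open>The four groups in terms of \<open>unit_mat\<close>\<close>

lemma orthogonal_group_eq: "orthogonal_group = {P :: real^'n^'n. unit_mat P}"
proof -
  have "adj P = transpose P" for P :: "real^'n^'n"
    by (simp add: adj_def transpose_def conjugate_real_def)
  then show ?thesis
    unfolding orthogonal_group_def orthogonal_matrix_def unit_mat_def
    by (auto simp: matrix_left_right_inverse)
qed

lemma unitary_group_eq: "unitary_group = {P :: complex^'n^'n. unit_mat P}"
proof -
  have "adj P = cadjoint P" for P :: "complex^'n^'n"
    by (simp add: adj_def cadjoint_def conjugate_complex_def)
  then show ?thesis
    unfolding unitary_group_def unitary_matrix_def unit_mat_def
    by (auto simp: matrix_left_right_inverse)
qed

lemma real_euclidean_group_eq: "real_euclidean_group = {(P, q). unit_mat P}"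
  using orthogonal_group_eq by (auto simp: real_euclidean_group_def orthogonal_group_def)

lemma complex_euclidean_group_eq: "complex_euclidean_group = {(P, q). unit_mat P}"
  using unitary_group_eq by (auto simp: complex_euclidean_group_def unitary_group_def)

lemma low_rank_count_real:
  fixes m n :: nat
  assumes "2 * n \<le> m + 1"
  shows "(\<Sum>k<m. min (2 * n) (m - k) * (if k = 0 then 1 else DIM(real))) = n * (2 * m + 1 - 2 * n)"
proof -
  have "(\<Sum>k<m. min (2 * n) (m - k)) + n * (2 * n) = n * (2 * m + 1)"
    using sum_min[OF assms] by (simp add: algebra_simps)
  then show ?thesis unfolding diff_mult_distrib2 DIM_real if_cancel mult_1_right by linarith
qed

lemma low_rank_count_complex:
  fixes m n :: nat
  assumes "2 * n \<le> m"
  shows "(\<Sum>k<m. min (2 * n) (m - k) * (if k = 0 then 1 else DIM(complex))) = 4 * n * (m - n)"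
proof (cases m)
  case (Suc m')
  have "(\<Sum>k<m. min (2 * n) (m - k) * (if k = 0 then 1 else 2)) + 4 * n * n = 4 * n * m"
    using sum_min[of "2 * n" m'] assms unfolding Suc sum_min_Suc by (simp add: algebra_simps)
  then show ?thesis unfolding DIM_complex diff_mult_distrib2 by linarith
qed (use assms in simp)

text \<open>One less than \<open>m * m\<close>, the real dimension of the Hermitian matrices of size
  \<open>m\<close>, in factored form.\<close>

lemma indefinite_count_complex:
  "(\<Sum>k<m. if k = 0 then m - 1 else (m - k) * DIM(complex)) = (m - 1) * (m + 1)"
proof (cases m)
  case (Suc m')
  have "(\<Sum>k<m'. m' - k) = (\<Sum>k<m'. min m' (m' - k))" by (intro sum.cong) auto
  then have "2 * (\<Sum>k<m'. m' - k) = m' * (m' + 1)" using sum_min_small[of m' m'] by simp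
  moreover have "(\<Sum>k<m. if k = 0 then m - 1 else (m - k) * 2) = m' + 2 * (\<Sum>k<m'. m' - k)"
    unfolding Suc sum.lessThan_Suc_shift by (simp add: sum_distrib_left mult.commute)
  ultimately have "(\<Sum>k<m. if k = 0 then m - 1 else (m - k) * 2) = m' + m' * (m' + 1)" by simp
  also have "\<dots> = (m - 1) * (m + 1)" by (simp add: Suc)
  finally show ?thesis unfolding DIM_complex .
qed simp

theorem theorem7:
  assumes "CARD('l::finite) \<ge> 2 * CARD('n::finite)"
  shows
    "(CARD('m1::finite) = CARD('n) * (2 * CARD('l) - 2 * CARD('n) + 1) \<longrightarrow>
        (\<exists>\<phi> :: real^'l^'n \<Rightarrow> real^'m1. bi_lipschitz_wrt orthogonal_group (**) \<phi>)) \<and>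
     (CARD('m2::finite) = CARD('n) * (2 * CARD('l) - 2 * CARD('n) - 1) \<longrightarrow>
        (\<exists>\<psi> :: real^'l^'n \<Rightarrow> real^'m2.
           bi_lipschitz_wrt real_euclidean_group affine_act_columns \<psi>)) \<and>
     (CARD('m3::finite) = 4 * CARD('n) * (CARD('l) - CARD('n)) \<longrightarrow>
        (\<exists>\<phi>\<^sub>C :: complex^'l^'n \<Rightarrow> real^'m3. bi_lipschitz_wrt unitary_group (**) \<phi>\<^sub>C)) \<and>
     (CARD('m4::finite) = 4 * CARD('n) * (CARD('l) - CARD('n) - 1) \<longrightarrow>
        (\<exists>\<psi>\<^sub>C :: complex^'l^'n \<Rightarrow> real^'m4.
           bi_lipschitz_wrt complex_euclidean_group affine_act_columns \<psi>\<^sub>C))"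
proof (intro conjI impI)
  have n: "CARD('n) > 0" by simp
  have le: "CARD('n) \<le> CARD('l)" using assms by linarith
  define j0 :: 'l where "j0 = undefined"
  define J where "J = UNIV - {j0}"
  have J: "card J = CARD('l) - 1" by (simp add: J_def)
  {
    assume m: "CARD('m1) = CARD('n) * (2 * CARD('l) - 2 * CARD('n) + 1)"
    have "2 * CARD('l) + 1 - 2 * CARD('n) = 2 * CARD('l) - 2 * CARD('n) + 1" using le by linarith
    then show "\<exists>\<phi> :: real^'l^'n \<Rightarrow> real^'m1. bi_lipschitz_wrt orthogonal_group (**) \<phi>"
      unfolding orthogonal_group_eq
      using low_rank_count_real[of "CARD('n)" "CARD('l)"] assms m
      by (intro bi_lipschitz_linear le) simp
  next
    assume m: "CARD('m2) = CARD('n) * (2 * CARD('l) - 2 * CARD('n) - 1)"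
    have "2 * card J + 1 - 2 * CARD('n) = 2 * CARD('l) - 2 * CARD('n) - 1"
      unfolding J using le n by linarith
    then show "\<exists>\<psi> :: real^'l^'n \<Rightarrow> real^'m2.
        bi_lipschitz_wrt real_euclidean_group affine_act_columns \<psi>"
      unfolding real_euclidean_group_eq
      using low_rank_count_real[of "CARD('n)" "card J"] assms m J
      by (intro bi_lipschitz_affine[OF le J_def] disjI1) simp
  next
    assume "CARD('m3) = 4 * CARD('n) * (CARD('l) - CARD('n))"
    then show "\<exists>\<phi>\<^sub>C :: complex^'l^'n \<Rightarrow> real^'m3. bi_lipschitz_wrt unitary_group (**) \<phi>\<^sub>C"
      unfolding unitary_group_eq
      using low_rank_count_complex[OF assms]
      by (intro bi_lipschitz_linear le) simp
  next
    assume m: "CARD('m4) = 4 * CARD('n) * (CARD('l) - CARD('n) - 1)"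
    have "(\<Sum>k<card J. min (2 * CARD('n)) (card J - k) * (if k = 0 then 1 else DIM(complex))) \<le> CARD('m4) \<or>
      CARD('n) < card J \<and> (\<Sum>k<card J. if k = 0 then card J - 1 else (card J - k) * DIM(complex)) \<le> CARD('m4)"
    proof (cases "2 * CARD('n) \<le> card J")
      case True
      have "card J - CARD('n) = CARD('l) - CARD('n) - 1" unfolding J by linarith
      then show ?thesis using low_rank_count_complex[OF True] m by simp
    next
      \<comment> \<open>Here \<open>card J = 2 * CARD('n) - 1\<close>, and the Hermitian matrices on
        \<open>J\<close> have one dimension more than the target, so indefiniteness is used.\<close>
      case False
      then have l: "CARD('l) = 2 * CARD('n)" using assms unfolding J by linarith
      \<comment> \<open>A type is never empty, so the target dimension is positive. This excludes
        \<open>CARD('n) = 1\<close> and yields \<open>CARD('n) < card J\<close>.\<close>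
      have "CARD('m4) > 0" by simp
      then have "CARD('l) - CARD('n) - 1 > 0" unfolding m by simp
      then have gt: "CARD('n) < card J" unfolding J using l by linarith
      have "card J - 1 = 2 * (CARD('l) - CARD('n) - 1)" "card J + 1 = 2 * CARD('n)"
        unfolding J l using n by linarith+
      then have "(card J - 1) * (card J + 1) = CARD('m4)" unfolding m by simp
      then show ?thesis using indefinite_count_complex[of "card J"] gt by simp
    qed
    then show "\<exists>\<psi>\<^sub>C :: complex^'l^'n \<Rightarrow> real^'m4.
        bi_lipschitz_wrt complex_euclidean_group affine_act_columns \<psi>\<^sub>C"
      unfolding complex_euclidean_group_eq by (rule bi_lipschitz_affine[OF le J_def])
  }
qed

end
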